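(* Let $(G=(A,B;E),c,L_G)$ be a capacitated instance of the Stable Matching Problem, and let $S$ be a subgraph of $G$ such that $d_S(v)\le c(v)$ for every $v\in A\cup B$. There exists a polynomial-time algorithm that finds a minimum-length sequence $\sigma_1,\dots,\sigma_k$ of swaps such that $S$ is a stable subgraph in the instance $(G,c,\sigma_k\circ\dots\circ\sigma_1(L_G))$.
   Context: An instance of the (capacitated) Stable Matching Problem consists of a bipartite graph $G=(A,B;E)$, a capacity function $c:A\cup B\to\mathbb{Z}_{+}$, and a set $L_G$ of preference lists: for every vertex $v\in A\cup B$, a list $\ell(v)=(u_1,\dots,u_{d(v)})$ ordering all neighbours of $v$ in $G$; $v$ prefers $u_i$ to $u_j$ if $i<j$. For a subgraph $S$ of $G$ with $d_S(v)\le c(v)$ for all $v$, an edge $ab\in E\setminus E(S)$ ($a\in A$, $b\in B$) is a blocking edge of $S$ if both: (i) $d_S(a)<c(a)$ or there is $b'$ with $ab'\in E(S)$ and $a$ prefers $b$ to $b'$; and (ii) $d_S(b)<c(b)$ or there is $a'$ with $a'b\in E(S)$ and $b$ prefers $a$ to $a'$. $S$ is stable if it has no blocking edges. A swap is the exchange of two consecutive elements of a single preference list $\ell(v)$; $\sigma(L_G)$ denotes the preference lists after applying swap $\sigma$. *)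

theory Defs
  imports Main "HOL-Computational_Algebra.Polynomial"
begin

section \<open>Capacitated stable matching\<close>

text \<open>A subgraph is represented by its set of edges, an edge \<open>ab\<close> with \<open>a \<in> A\<close>,
  \<open>b \<in> B\<close> by the pair \<open>(a, b)\<close>.\<close>

record 'v smp =
  sideA :: "'v set"
  sideB :: "'v set"
  edges :: "('v \<times> 'v) set"
  cap :: "'v \<Rightarrow> nat"
  pref :: "'v \<Rightarrow> 'v list"

definition verts :: "'v smp \<Rightarrow> 'v set" where
  "verts I = sideA I \<union> sideB I"

definition neighbours :: "('v \<times> 'v) set \<Rightarrow> 'v \<Rightarrow> 'v set" where
  "neighbours F v = {u. (v, u) \<in> F \<or> (u, v) \<in> F}"

definition degree_in :: "('v \<times> 'v) set \<Rightarrow> 'v \<Rightarrow> nat" where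
  "degree_in F v = card (neighbours F v)"

definition smp_instance :: "'v smp \<Rightarrow> bool" where
  "smp_instance I \<longleftrightarrow>
     finite (sideA I) \<and> finite (sideB I) \<and> sideA I \<inter> sideB I = {} \<and>
     edges I \<subseteq> sideA I \<times> sideB I \<and>
     (\<forall>v \<in> verts I. distinct (pref I v) \<and> set (pref I v) = neighbours (edges I) v)"

definition prefers :: "'v smp \<Rightarrow> 'v \<Rightarrow> 'v \<Rightarrow> 'v \<Rightarrow> bool" where
  "prefers I v u w \<longleftrightarrow>
     (\<exists>i j. i < j \<and> j < length (pref I v) \<and> pref I v ! i = u \<and> pref I v ! j = w)"

definition blocking_edge :: "'v smp \<Rightarrow> ('v \<times> 'v) set \<Rightarrow> 'v \<Rightarrow> 'v \<Rightarrow> bool" where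
  "blocking_edge I S a b \<longleftrightarrow>
     (a, b) \<in> edges I - S \<and>
     (degree_in S a < cap I a \<or> (\<exists>b'. (a, b') \<in> S \<and> prefers I a b b')) \<and>
     (degree_in S b < cap I b \<or> (\<exists>a'. (a', b) \<in> S \<and> prefers I b a a'))"

definition stable :: "'v smp \<Rightarrow> ('v \<times> 'v) set \<Rightarrow> bool" where
  "stable I S \<longleftrightarrow> (\<nexists>a b. blocking_edge I S a b)"


section \<open>Swaps\<close>

text \<open>The swap \<open>(v, i)\<close> exchanges the entries at positions \<open>i\<close> and \<open>i + 1\<close>
  (counted from 0) of the list of \<open>v\<close>.\<close>

definition swaps :: "'v smp \<Rightarrow> ('v \<times> nat) set" where
  "swaps I = {(v, i). v \<in> verts I \<and> Suc i < length (pref I v)}"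

fun apply_swap :: "'v \<times> nat \<Rightarrow> ('v \<Rightarrow> 'v list) \<Rightarrow> ('v \<Rightarrow> 'v list)" where
  "apply_swap (v, i) L = L(v := (L v)[i := L v ! Suc i, Suc i := L v ! i])"

text \<open>Swaps do not change the lengths of the lists, so a swap is applicable at some stage
  iff it is applicable to the original lists.\<close>

definition stabilizing :: "'v smp \<Rightarrow> ('v \<times> 'v) set \<Rightarrow> ('v \<times> nat) list \<Rightarrow> bool" where
  "stabilizing I S \<sigma>s \<longleftrightarrow>
     set \<sigma>s \<subseteq> swaps I \<and> stable (I\<lparr>pref := fold apply_swap \<sigma>s (pref I)\<rparr>) S"


section \<open>Model of computation\<close>

text \<open>
  Programs are those of a While language on binary trees, in the style of Jones
  (\<^emph>\<open>Computability and Complexity\<close>, 1997), without variables: a program maps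
  one tree to one tree, and several values are held together by \<open>Node\<close>.

  In \<open>exec p x y t\<close>, program \<open>p\<close> halts on input \<open>x\<close> with output \<open>y\<close> at cost \<open>t\<close>.
  A step is not charged 1 but at least the size of the tree it copies (hence \<open>size y < t\<close>, and
  repeated doubling of a tree is not cheap). The cost is thus polynomially related,
  relative to the size of the input, to running time on a Turing machine.
\<close>

datatype tree = Leaf | Node tree tree

datatype prog =
    PId
  | PLeaf
  | PLeft
  | PRight
  | PNode prog prog
  | PSeq prog prog
  | PIf prog prog prog
  | PWhile prog prog

inductive exec :: "prog \<Rightarrow> tree \<Rightarrow> tree \<Rightarrow> nat \<Rightarrow> bool" where
  Id: "exec PId x x (1 + size x)"
| Leaf: "exec PLeaf x Leaf 1"
| Left: "exec PLeft (Node l r) l (1 + size l)"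
| Left_Leaf: "exec PLeft Leaf Leaf 1"
| Right: "exec PRight (Node l r) r (1 + size r)"
| Right_Leaf: "exec PRight Leaf Leaf 1"
| Node: "exec p x y s \<Longrightarrow> exec q x z t \<Longrightarrow> exec (PNode p q) x (Node y z) (1 + s + t)"
| Seq: "exec p x y s \<Longrightarrow> exec q y z t \<Longrightarrow> exec (PSeq p q) x z (1 + s + t)"
| If_True: "exec b x (Node l r) s \<Longrightarrow> exec p x y t \<Longrightarrow> exec (PIf b p q) x y (1 + s + t)"
| If_False: "exec b x Leaf s \<Longrightarrow> exec q x y t \<Longrightarrow> exec (PIf b p q) x y (1 + s + t)"
| While_True: "exec b x (Node l r) s \<Longrightarrow> exec p x y t \<Longrightarrow> exec (PWhile b p) y z u
    \<Longrightarrow> exec (PWhile b p) x z (1 + s + t + u)"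
| While_False: "exec b x Leaf s \<Longrightarrow> exec (PWhile b p) x x (1 + s + size x)"

inductive_cases exec_elims:
  "exec PId x y t" "exec PLeaf x y t" "exec PLeft x y t" "exec PRight x y t"
  "exec (PNode p q) x y t" "exec (PSeq p q) x y t" "exec (PIf b p q) x y t"
  "exec (PWhile b p) x y t"

lemma exec_deterministic:
  "exec p x y t \<Longrightarrow> exec p x y' t' \<Longrightarrow> y' = y \<and> t' = t"
proof (induction arbitrary: y' t' rule: exec.induct)
  case (Node p x y s q z t)
  from Node.prems show ?case
    by (rule exec_elims) (simp; metis Node.IH tree.distinct(1))+
next
  case (Seq p x y s q z t)
  from Seq.prems show ?case
    by (rule exec_elims) (simp; metis Seq.IH tree.distinct(1))+
next
  case (If_True b x l r s p y t q)
  from If_True.prems show ?case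
    by (rule exec_elims) (simp; metis If_True.IH tree.distinct(1))+
next
  case (If_False b x s q y t p)
  from If_False.prems show ?case
    by (rule exec_elims) (simp; metis If_False.IH tree.distinct(1))+
next
  case (While_True b x l r s p y t z u)
  from While_True.prems show ?case
    by (rule exec_elims) (simp; metis While_True.IH tree.distinct(1))+
next
  case (While_False b x s p)
  from While_False.prems show ?case
    by (rule exec_elims) (simp; metis While_False.IH tree.distinct(1))+
qed (erule exec_elims; simp)+

lemma exec_size: "exec p x y t \<Longrightarrow> size y < t"
  by (induction rule: exec.induct) auto


section \<open>Encoding of inputs and outputs\<close>

text \<open>Numbers are encoded in binary, least significant bit first.\<close>

fun enc_nat :: "nat \<Rightarrow> tree" where
  "enc_nat n =
     (if n = 0 then Leaf
      else Node (if odd n then Node Leaf Leaf else Leaf) (enc_nat (n div 2)))"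

declare enc_nat.simps [simp del]

definition enc_list :: "('a \<Rightarrow> tree) \<Rightarrow> 'a list \<Rightarrow> tree" where
  "enc_list f xs = foldr (\<lambda>x. Node (f x)) xs Leaf"

definition enc_pair :: "('a \<Rightarrow> tree) \<Rightarrow> ('b \<Rightarrow> tree) \<Rightarrow> 'a \<times> 'b \<Rightarrow> tree" where
  "enc_pair f g z = Node (f (fst z)) (g (snd z))"

definition enc_option :: "('a \<Rightarrow> tree) \<Rightarrow> 'a option \<Rightarrow> tree" where
  "enc_option f z = (case z of None \<Rightarrow> Leaf | Some x \<Rightarrow> Node (f x) Leaf)"

definition enc_vertex :: "nat smp \<Rightarrow> nat \<Rightarrow> tree" where
  "enc_vertex I v = Node (enc_nat v) (Node (enc_nat (cap I v)) (enc_list enc_nat (pref I v)))"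

text \<open>\<open>encodes x I S\<close>: the tree \<open>x\<close> describes \<open>(I, S)\<close>, its finite sets being listed without
  repetition in an arbitrary order.\<close>

definition encodes :: "tree \<Rightarrow> nat smp \<Rightarrow> (nat \<times> nat) set \<Rightarrow> bool" where
  "encodes x I S \<longleftrightarrow>
     (\<exists>As Bs Es Ss.
        distinct As \<and> set As = sideA I \<and>
        distinct Bs \<and> set Bs = sideB I \<and>
        distinct Es \<and> set Es = edges I \<and>
        distinct Ss \<and> set Ss = S \<and>
        x = Node (Node (enc_list (enc_vertex I) As) (enc_list (enc_vertex I) Bs))
                 (Node (enc_list (enc_pair enc_nat enc_nat) Es)
                       (enc_list (enc_pair enc_nat enc_nat) Ss)))"

definition enc_output :: "(nat \<times> nat) list option \<Rightarrow> tree" where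
  "enc_output = enc_option (enc_list (enc_pair enc_nat enc_nat))"

lemma enc_nat_inject: "enc_nat m = enc_nat n \<longleftrightarrow> m = n"
proof (induction m arbitrary: n rule: less_induct)
  case (less m)
  show ?case
  proof (cases "m = 0 \<or> n = 0")
    case True
    then show ?thesis by (subst (1 2) enc_nat.simps) auto
  next
    case False
    then have "enc_nat m = enc_nat n \<longleftrightarrow> odd m = odd n \<and> enc_nat (m div 2) = enc_nat (n div 2)"
      by (subst (1 2) enc_nat.simps) auto
    also have "\<dots> \<longleftrightarrow> odd m = odd n \<and> m div 2 = n div 2"
      using less.IH[of "m div 2" "n div 2"] False by simp
    also have "\<dots> \<longleftrightarrow> m = n"
      by presburger
    finally show ?thesis .
  qed
qed

lemma inj_enc_list: "inj f \<Longrightarrow> inj (enc_list f)"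
proof (rule injI)
  fix xs ys assume "inj f" "enc_list f xs = enc_list f ys"
  then show "xs = ys"
  proof (induction xs arbitrary: ys)
    case Nil
    then show ?case by (cases ys) (auto simp: enc_list_def)
  next
    case (Cons x xs)
    then show ?case by (cases ys) (auto simp: enc_list_def dest: injD)
  qed
qed

lemma inj_enc_pair: "inj f \<Longrightarrow> inj g \<Longrightarrow> inj (enc_pair f g)"
  by (auto simp: inj_def enc_pair_def)

lemma inj_enc_option: "inj f \<Longrightarrow> inj (enc_option f)"
  by (auto simp: inj_def enc_option_def split: option.splits)

lemma inj_enc_output: "inj enc_output"
  unfolding enc_output_def
  by (intro inj_enc_option inj_enc_list inj_enc_pair) (auto intro: injI simp: enc_nat_inject)

end

theory Submission
  imports Defs "HOL-Library.Multiset"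
begin

text \<open>
  An edge \<open>ab\<close> outside \<open>S\<close> is not blocking iff at \<open>a\<close> or at \<open>b\<close> all places are taken by partners
  that precede the other end of the edge. Let \<open>D\<^sub>v\<close> be the set of neighbours of a vertex \<open>v\<close> that
  end up behind all its partners; \<open>D\<^sub>v\<close> is empty unless all places of \<open>v\<close> are taken. Every pair
  \<open>(x, y)\<close> with \<open>x \<in> D\<^sub>v\<close>, \<open>y \<notin> D\<^sub>v\<close> and \<open>x\<close> before \<open>y\<close> in \<open>\<ell>(v)\<close> costs a swap, and moving \<open>D\<^sub>v\<close> to the
  end of the list, without changing the order inside and outside \<open>D\<^sub>v\<close>, costs no more. This cost is a
  cut function, and since the graph is bipartite, the conditions "\<open>b \<in> D\<^sub>a\<close> or \<open>a \<in> D\<^sub>b\<close>" become arcs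
  that must not be cut after complementing the sets \<open>D\<^sub>b\<close> with \<open>b \<in> B\<close>. So the task is a minimum
  cut problem with arcs of unit cost, which is solved by repeatedly reversing a path from a source to
  a sink.

  To exhibit a program, the polynomial-time functions on encoded data are shown to be closed
  under composition, case distinction, and recursion on lists with results of polynomial size.
\<close>

section \<open>Polynomial-time functions\<close>

class enc =
  fixes enc :: "'a \<Rightarrow> tree"

instantiation tree :: enc
begin
definition tree_enc: "enc (x :: tree) = x"
instance ..
end

instantiation nat :: enc
begin
definition nat_enc: "enc (n :: nat) = enc_nat n"
instance ..
end

instantiation bool :: enc
begin
definition bool_enc: "enc b = (if b then Node Leaf Leaf else Leaf)"
instance ..
end

instantiation prod :: (enc, enc) enc
begin
definition prod_enc: "enc (z :: 'a \<times> 'b) = enc_pair enc enc z"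
instance ..
end

instantiation list :: (enc) enc
begin
definition list_enc: "enc (xs :: 'a list) = enc_list enc xs"
instance ..
end

instantiation option :: (enc) enc
begin
definition option_enc: "enc (z :: 'a option) = enc_option enc z"
instance ..
end

lemma enc_simps [simp]:
  "enc True = Node Leaf Leaf" "enc False = Leaf"
  "enc (a, b) = Node (enc a) (enc b)"
  "enc [] = Leaf" "enc (x # xs) = Node (enc x) (enc xs)"
  "enc None = Leaf" "enc (Some y) = Node (enc y) Leaf"
  by (simp_all add: bool_enc prod_enc list_enc option_enc enc_list_def enc_pair_def enc_option_def)

named_theorems ptime_intros

definition ptime :: "('a::enc \<Rightarrow> 'b::enc) \<Rightarrow> bool" where
  "ptime f \<longleftrightarrow>
     (\<exists>p q. \<forall>x. \<exists>t. exec p (enc x) (enc (f x)) t \<and> t \<le> poly q (size (enc x)))"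

definition psize :: "('a::enc \<Rightarrow> 'b::enc) \<Rightarrow> bool" where
  "psize f \<longleftrightarrow> (\<exists>q. \<forall>x. size (enc (f x)) \<le> poly q (size (enc x)))"

text \<open>The coefficients are natural numbers, so every polynomial is monotone, and a bound on
  the size of an intermediate value can be substituted into a running time.\<close>

lemma poly_nat_mono: "m \<le> n \<Longrightarrow> poly q m \<le> poly q n" for m n :: nat
  by (induction q) (auto intro!: add_mono mult_mono)

lemma ptimeI:
  assumes "\<And>x. \<exists>t. exec p (enc x) (enc (f x)) t \<and> t \<le> poly q (size (enc x))"
  shows "ptime f"
  using assms unfolding ptime_def by blast

lemma ptimeE:
  assumes "ptime f"
  obtains p q t where
    "\<And>x. exec p (enc x) (enc (f x)) (t x)" "\<And>x. t x \<le> poly q (size (enc x))"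
  using assms unfolding ptime_def by metis

lemma ptime_psize: "ptime f \<Longrightarrow> psize f"
  unfolding psize_def by (metis ptimeE exec_size less_le_trans less_imp_le)

lemma psizeI: "(\<And>x. size (enc (f x)) \<le> poly q (size (enc x))) \<Longrightarrow> psize f"
  unfolding psize_def by blast

text \<open>Programs see only codes, so a conversion between values with equal codes is
  free.\<close>

lemma ptime_recode: "ptime f \<Longrightarrow> (\<And>x. enc (g x) = enc (f x)) \<Longrightarrow> ptime g"
  unfolding ptime_def by simp

section \<open>Closure under composition, pairing and case distinction\<close>

lemma ptime_id [ptime_intros]: "ptime (\<lambda>x. x)"
  by (rule ptimeI[where p = PId and q = "[:1, 1:]"]) (auto intro: exec.Id)

lemma exec_const: "\<exists>p t. \<forall>x. exec p x y t"
proof (induction y)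
  case Leaf
  then show ?case using exec.Leaf by blast
next
  case (Node y z)
  then show ?case using exec.Node by metis
qed

lemma ptime_const [ptime_intros]: "ptime (\<lambda>x. c)"
proof -
  obtain p t where "\<forall>x. exec p x (enc c) t" using exec_const by blast
  then show ?thesis by (intro ptimeI[where p = p and q = "[:t:]"]) auto
qed

text \<open>The size of an output is below the cost of producing it (\<open>exec_size\<close>), so
  the inner running time also bounds the input of the outer program.\<close>

lemma ptime_comp:
  assumes "ptime f" "ptime g"
  shows "ptime (\<lambda>x. f (g x))"
proof -
  obtain p t q where f: "\<And>x. exec p (enc x) (enc (f x)) (t x)" "\<And>x. t x \<le> poly q (size (enc x))"
    using assms(1) by (rule ptimeE) (rule that)
  obtain p' t' q' where g: "\<And>x. exec p' (enc x) (enc (g x)) (t' x)"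
      "\<And>x. t' x \<le> poly q' (size (enc x))"
    using assms(2) by (rule ptimeE) (rule that)
  have "t (g x) \<le> poly (q \<circ>\<^sub>p q') (size (enc x))" for x
  proof -
    have "size (enc (g x)) \<le> poly q' (size (enc x))"
      using exec_size[OF g(1)] g(2)[of x] by (meson less_imp_le order_trans)
    then show ?thesis
      using f(2)[of "g x"] poly_nat_mono[of _ _ q] by (fastforce simp: poly_pcompose intro: order_trans)
  qed
  then have "1 + t' x + t (g x) \<le> poly (1 + q' + q \<circ>\<^sub>p q') (size (enc x))" for x
    using g(2)[of x] by (simp add: add_mono)
  then show ?thesis
    using exec.Seq[OF g(1) f(1)] by (intro ptimeI[where p = "PSeq p' p"]) blast
qed

lemma ptime_Pair [ptime_intros]:
  assumes "ptime f" "ptime g"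
  shows "ptime (\<lambda>x. (f x, g x))"
proof -
  obtain p t q where f: "\<And>x. exec p (enc x) (enc (f x)) (t x)" "\<And>x. t x \<le> poly q (size (enc x))"
    using assms(1) by (rule ptimeE) (rule that)
  obtain p' t' q' where g: "\<And>x. exec p' (enc x) (enc (g x)) (t' x)"
      "\<And>x. t' x \<le> poly q' (size (enc x))"
    using assms(2) by (rule ptimeE) (rule that)
  show ?thesis
    by (rule ptimeI[where p = "PNode p p'" and q = "1 + q + q'"])
      (use exec.Node[OF f(1) g(1)] in \<open>fastforce intro: add_mono f(2) g(2)\<close>)
qed

lemma ptime_comp2:
  assumes "ptime (\<lambda>z. f (fst z) (snd z))" "ptime g" "ptime h"
  shows "ptime (\<lambda>x. f (g x) (h x))"
  using ptime_comp[OF assms(1) ptime_Pair[OF assms(2,3)]] by simp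

lemma ptime_fst [ptime_intros]:
  fixes f :: "'a::enc \<Rightarrow> 'b::enc \<times> 'c::enc"
  shows "ptime f \<Longrightarrow> ptime (\<lambda>x. fst (f x))"
proof (erule ptime_comp[where f = fst, rotated], rule ptimeI[where p = PLeft and q = "[:1, 1:]"])
  fix z :: "'b \<times> 'c"
  show "\<exists>t. exec PLeft (enc z) (enc (fst z)) t \<and> t \<le> poly [:1, 1:] (size (enc z))"
    by (cases z) (auto intro!: exI exec.Left)
qed

lemma ptime_snd [ptime_intros]:
  fixes f :: "'a::enc \<Rightarrow> 'b::enc \<times> 'c::enc"
  shows "ptime f \<Longrightarrow> ptime (\<lambda>x. snd (f x))"
proof (erule ptime_comp[where f = snd, rotated], rule ptimeI[where p = PRight and q = "[:1, 1:]"])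
  fix z :: "'b \<times> 'c"
  show "\<exists>t. exec PRight (enc z) (enc (snd z)) t \<and> t \<le> poly [:1, 1:] (size (enc z))"
    by (cases z) (auto intro!: exI exec.Right)
qed

text \<open>The cell \<open>x # xs\<close> has the same code as the pair \<open>(x, xs)\<close>.\<close>

lemma ptime_Cons [ptime_intros]: "ptime f \<Longrightarrow> ptime g \<Longrightarrow> ptime (\<lambda>x. f x # g x)"
  using ptime_Pair[of f g] unfolding ptime_def by simp

lemma ptime_Some [ptime_intros]: "ptime f \<Longrightarrow> ptime (\<lambda>x. Some (f x))"
  using ptime_Pair[OF _ ptime_const[of Leaf], of f] unfolding ptime_def
  by (simp add: tree_enc)

text \<open>The body is treated as a function of one pair, made of the environment \<open>x\<close>
  and the bound value; the rules for \<open>map\<close> and \<open>filter\<close> have the same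
  form.\<close>

lemma ptime_Let [ptime_intros]:
  assumes "ptime g" "ptime (\<lambda>z. f (fst z) (snd z))"
  shows "ptime (\<lambda>x. let y = g x in f x y)"
  using ptime_comp[OF assms(2) ptime_Pair[OF ptime_id assms(1)]] by simp

lemma ptime_case_prod [ptime_intros]:
  assumes "ptime (\<lambda>x. f x (fst (g x)) (snd (g x)))"
  shows "ptime (\<lambda>x. case g x of (a, b) \<Rightarrow> f x a b)"
  using assms by (simp add: case_prod_beta)

text \<open>\<open>PIf\<close> only tells \<open>Leaf\<close> from \<open>Node\<close>, so one rule
  yields \<open>if\<close> and the Boolean connectives.\<close>

lemma ptime_case_code:
  assumes c: "ptime c" and f: "ptime f" and g: "ptime g"
    and h: "\<And>x. enc (h x) = (case enc (c x) of Leaf \<Rightarrow> enc (f x) | Node _ _ \<Rightarrow> enc (g x))"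
  shows "ptime h"
proof -
  obtain p1 t1 q1 where 1: "\<And>x. exec p1 (enc x) (enc (c x)) (t1 x)"
      "\<And>x. t1 x \<le> poly q1 (size (enc x))"
    using c by (rule ptimeE) (rule that)
  obtain p2 t2 q2 where 2: "\<And>x. exec p2 (enc x) (enc (f x)) (t2 x)"
      "\<And>x. t2 x \<le> poly q2 (size (enc x))"
    using f by (rule ptimeE) (rule that)
  obtain p3 t3 q3 where 3: "\<And>x. exec p3 (enc x) (enc (g x)) (t3 x)"
      "\<And>x. t3 x \<le> poly q3 (size (enc x))"
    using g by (rule ptimeE) (rule that)
  show ?thesis
  proof (rule ptimeI[where p = "PIf p1 p3 p2" and q = "1 + q1 + q2 + q3"])
    fix x
    show "\<exists>t. exec (PIf p1 p3 p2) (enc x) (enc (h x)) t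
        \<and> t \<le> poly (1 + q1 + q2 + q3) (size (enc x))"
    proof (cases "enc (c x)")
      case Leaf
      then have "exec (PIf p1 p3 p2) (enc x) (enc (h x)) (1 + t1 x + t2 x)"
        using exec.If_False[of p1 "enc x"] 1(1)[of x] 2(1)[of x] by (simp add: h)
      moreover have "1 + t1 x + t2 x \<le> poly (1 + q1 + q2 + q3) (size (enc x))"
        using 1(2)[of x] 2(2)[of x] by simp
      ultimately show ?thesis by blast
    next
      case (Node l r)
      then have "exec (PIf p1 p3 p2) (enc x) (enc (h x)) (1 + t1 x + t3 x)"
        using exec.If_True[of p1 "enc x"] 1(1)[of x] 3(1)[of x] by (simp add: h)
      moreover have "1 + t1 x + t3 x \<le> poly (1 + q1 + q2 + q3) (size (enc x))"
        using 1(2)[of x] 3(2)[of x] by simp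
      ultimately show ?thesis by blast
    qed
  qed
qed

lemma ptime_If [ptime_intros]:
  assumes "ptime c" "ptime f" "ptime g"
  shows "ptime (\<lambda>x. if c x then f x else g x)"
  by (rule ptime_case_code[OF assms(1,3,2)]) auto

lemma ptime_True: "ptime (\<lambda>x. True)" and ptime_False: "ptime (\<lambda>x. False)"
  by (rule ptime_const)+

lemma ptime_not [ptime_intros]: "ptime c \<Longrightarrow> ptime (\<lambda>x. \<not> c x)"
  by (rule ptime_case_code[OF _ ptime_True ptime_False, of c]) (auto simp: bool_enc)

lemma ptime_conj [ptime_intros]: "ptime c \<Longrightarrow> ptime d \<Longrightarrow> ptime (\<lambda>x. c x \<and> d x)"
  by (rule ptime_case_code[OF _ ptime_False, of c d]) (auto simp: bool_enc)

lemma ptime_disj [ptime_intros]: "ptime c \<Longrightarrow> ptime d \<Longrightarrow> ptime (\<lambda>x. c x \<or> d x)"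
  by (rule ptime_case_code[OF _ _ ptime_True, of c d]) (auto simp: bool_enc)

lemma ptime_case_list [ptime_intros]:
  assumes c: "ptime c" and f: "ptime f" and g: "ptime (\<lambda>z. g (fst z) (fst (snd z)) (snd (snd z)))"
  shows "ptime (\<lambda>x. case c x of [] \<Rightarrow> f x | y # ys \<Rightarrow> g x y ys)"
proof -
  let ?h = "\<lambda>x. case c x of [] \<Rightarrow> f x | y # ys \<Rightarrow> g x y ys"
  obtain p1 t1 q1 where 1: "\<And>x. exec p1 (enc x) (enc (c x)) (t1 x)"
      "\<And>x. t1 x \<le> poly q1 (size (enc x))"
    using c by (rule ptimeE) (rule that)
  obtain p2 t2 q2 where 2: "\<And>x. exec p2 (enc x) (enc (f x)) (t2 x)"
      "\<And>x. t2 x \<le> poly q2 (size (enc x))"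
    using f by (rule ptimeE) (rule that)
  obtain p3 t3 q3 where 3: "\<And>z. exec p3 (enc z) (enc (g (fst z) (fst (snd z)) (snd (snd z)))) (t3 z)"
      "\<And>z. t3 z \<le> poly q3 (size (enc z))"
    using g by (rule ptimeE) (rule that)
  \<comment> \<open>\<open>PNode PId p1\<close> pairs the environment with the list; since a cell
    has the code of a pair, the result encodes \<open>(x, y, ys)\<close>. As \<open>p1\<close> runs
    a second time, \<open>q1\<close> counts twice in \<open>?q\<close>.\<close>
  let ?p = "PIf p1 (PSeq (PNode PId p1) p3) p2"
  let ?q = "4 + [:0, 1:] + 2 * q1 + q2 + q3 \<circ>\<^sub>p (1 + [:0, 1:] + q1)"
  show ?thesis
  proof (rule ptimeI[where p = ?p and q = ?q])
    fix x
    show "\<exists>t. exec ?p (enc x) (enc (?h x)) t \<and> t \<le> poly ?q (size (enc x))"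
    proof (cases "c x")
      case Nil
      then have "exec ?p (enc x) (enc (?h x)) (1 + t1 x + t2 x)"
        using exec.If_False[of p1 "enc x"] 1(1)[of x] 2(1)[of x] by simp
      moreover have "1 + t1 x + t2 x \<le> poly ?q (size (enc x))"
        using 1(2)[of x] 2(2)[of x] by simp
      ultimately show ?thesis by blast
    next
      case (Cons y ys)
      let ?z = "(x, y, ys)"
      have z: "exec (PNode PId p1) (enc x) (enc ?z) (1 + (1 + size (enc x)) + t1 x)"
        using exec.Node[OF exec.Id 1(1), of x] Cons by simp
      have e: "exec ?p (enc x) (enc (?h x)) (1 + t1 x + (1 + (1 + (1 + size (enc x)) + t1 x) + t3 ?z))"
        using exec.If_True[OF _ exec.Seq[OF z 3(1)]] 1(1)[of x] Cons by simp
      have "size (enc ?z) \<le> poly (1 + [:0, 1:] + q1) (size (enc x))"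
        using exec_size[OF 1(1), of x] 1(2)[of x] Cons by simp
      from poly_nat_mono[OF this, of q3] 3(2)[of ?z]
      have "t3 ?z \<le> poly (q3 \<circ>\<^sub>p (1 + [:0, 1:] + q1)) (size (enc x))"
        by (simp add: poly_pcompose)
      then show ?thesis
        using 1(2)[of x] e by (intro exI[of _ "1 + t1 x + (1 + (1 + (1 + size (enc x)) + t1 x) + t3 ?z)"]) simp
    qed
  qed
qed

text \<open>\<open>None\<close> has the code of \<open>[]\<close> and \<open>Some y\<close> that of
  \<open>[y]\<close>, which reduces the claim to lists.\<close>

lemma ptime_case_option [ptime_intros]:
  assumes c: "ptime c" and f: "ptime f" and g: "ptime (\<lambda>z. g (fst z) (snd z))"
  shows "ptime (\<lambda>x. case c x of None \<Rightarrow> f x | Some y \<Rightarrow> g x y)"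
proof -
  have "ptime (\<lambda>x. case (case c x of None \<Rightarrow> [] | Some y \<Rightarrow> [y]) of [] \<Rightarrow> f x | y # ys \<Rightarrow> g x y)"
  proof (rule ptime_case_list[OF _ f])
    show "ptime (\<lambda>x. case c x of None \<Rightarrow> [] | Some y \<Rightarrow> [y])"
      by (rule ptime_recode[OF c]) (auto split: option.split)
    show "ptime (\<lambda>z. g (fst z) (fst (snd z)))"
      by (intro ptime_comp2[OF g] ptime_intros)
  qed
  then show ?thesis
    by (rule back_subst[where P = ptime]) (auto split: option.split)
qed

section \<open>Loops and recursion on lists\<close>

lemma ptime_while:
  fixes st :: "'a::enc \<Rightarrow> nat \<Rightarrow> 's::enc"
  assumes init: "ptime (\<lambda>x. st x 0)" and b: "ptime b" and step: "ptime step"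
    and run: "\<And>x i. i < n x \<Longrightarrow> b (st x i) \<and> step (st x i) = st x (Suc i)"
    and stop: "\<And>x. \<not> b (st x (n x))"
    and size_le: "\<And>x i. i \<le> n x \<Longrightarrow> size (enc (st x i)) \<le> poly q (size (enc x))"
    and n_le: "\<And>x. n x \<le> poly r (size (enc x))"
  shows "ptime (\<lambda>x. st x (n x))"
proof -
  obtain p0 t0 q0 where 0: "\<And>x. exec p0 (enc x) (enc (st x 0)) (t0 x)"
      "\<And>x. t0 x \<le> poly q0 (size (enc x))"
    using init by (rule ptimeE) (rule that)
  obtain p1 t1 q1 where 1: "\<And>x. exec p1 (enc x) (enc (b x)) (t1 x)"
      "\<And>x. t1 x \<le> poly q1 (size (enc x))"
    using b by (rule ptimeE) (rule that)
  obtain p2 t2 q2 where 2: "\<And>x. exec p2 (enc x) (enc (step x)) (t2 x)"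
      "\<And>x. t2 x \<le> poly q2 (size (enc x))"
    using step by (rule ptimeE) (rule that)
  \<comment> \<open>\<open>?c\<close> bounds one round: test, body and, at the end, the copy of the
    state. Its parts are evaluated at the common bound \<open>q\<close> on all states, which
    excludes exponential growth over the rounds.\<close>
  let ?c = "1 + q1 \<circ>\<^sub>p q + q2 \<circ>\<^sub>p q + q"
  \<comment> \<open>The factor counts the remaining rounds and the final failing test.\<close>
  have loop: "\<exists>t \<le> (Suc (n x) - i) * poly ?c (size (enc x)).
      exec (PWhile p1 p2) (enc (st x i)) (enc (st x (n x))) t" if "i \<le> n x" for x i
    using that
  proof (induction i rule: inc_induct)
    case base
    have "exec (PWhile p1 p2) (enc (st x (n x))) (enc (st x (n x)))
        (1 + t1 (st x (n x)) + size (enc (st x (n x))))"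
      using 1(1)[of "st x (n x)"] stop[of x] by (intro exec.While_False) simp
    moreover have "t1 (st x (n x)) \<le> poly (q1 \<circ>\<^sub>p q) (size (enc x))"
      using 1(2)[of "st x (n x)"] poly_nat_mono[OF size_le[of "n x" x], of q1]
      by (simp add: poly_pcompose)
    ultimately show ?case
      using size_le[of "n x" x] by (intro exI conjI) auto
  next
    case (step i)
    let ?y = "st x i"
    obtain t where t: "t \<le> (Suc (n x) - Suc i) * poly ?c (size (enc x))"
        "exec (PWhile p1 p2) (enc (st x (Suc i))) (enc (st x (n x))) t"
      using step.IH by blast
    have "enc (b ?y) = Node Leaf Leaf" "step ?y = st x (Suc i)"
      using run[OF step.hyps(2)] by simp_all
    then have e: "exec (PWhile p1 p2) (enc ?y) (enc (st x (n x))) (1 + t1 ?y + t2 ?y + t)"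
      using 1(1)[of ?y] 2(1)[of ?y] t(2) by (intro exec.While_True) auto
    have y: "size (enc ?y) \<le> poly q (size (enc x))"
      using size_le step.hyps by simp
    have "t1 ?y \<le> poly (q1 \<circ>\<^sub>p q) (size (enc x))"
      using 1(2)[of ?y] poly_nat_mono[OF y, of q1] by (simp add: poly_pcompose)
    moreover have "t2 ?y \<le> poly (q2 \<circ>\<^sub>p q) (size (enc x))"
      using 2(2)[of ?y] poly_nat_mono[OF y, of q2] by (simp add: poly_pcompose)
    ultimately have "1 + t1 ?y + t2 ?y + t
        \<le> poly ?c (size (enc x)) + (Suc (n x) - Suc i) * poly ?c (size (enc x))"
      using t(1) by simp
    also have "\<dots> = (Suc (n x) - i) * poly ?c (size (enc x))"
      unfolding mult_Suc[symmetric] using step.hyps(2) by (simp only: diff_Suc_Suc Suc_diff_le less_imp_le)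
    finally show ?case using e by blast
  qed
  show ?thesis
  proof (rule ptimeI[where p = "PSeq p0 (PWhile p1 p2)" and q = "1 + q0 + (1 + r) * ?c"])
    fix x
    obtain t where t: "t \<le> Suc (n x) * poly ?c (size (enc x))"
        "exec (PWhile p1 p2) (enc (st x 0)) (enc (st x (n x))) t"
      using loop[of 0 x] by auto
    have "t \<le> (1 + poly r (size (enc x))) * poly ?c (size (enc x))"
      using t(1) n_le[of x] by (elim order_trans) (intro mult_right_mono, auto)
    then have "1 + t0 x + t \<le> poly (1 + q0 + (1 + r) * ?c) (size (enc x))"
      using 0(2)[of x] by simp
    then show "\<exists>t. exec (PSeq p0 (PWhile p1 p2)) (enc x) (enc (st x (n x))) t
        \<and> t \<le> poly (1 + q0 + (1 + r) * ?c) (size (enc x))"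
      using exec.Seq[OF 0(1) t(2)] by blast
  qed
qed

lemma length_le_size_enc: "length xs \<le> size (enc xs)"
  by (induction xs) auto

lemma size_enc_append: "size (enc (xs @ ys)) = size (enc xs) + size (enc ys)"
  by (induction xs) auto

lemma size_enc_rev: "size (enc (rev xs)) = size (enc xs)"
  by (induction xs) (auto simp: size_enc_append)

lemma size_enc_take: "size (enc (take i xs)) \<le> size (enc xs)"
  using size_enc_append[of "take i xs" "drop i xs"] by simp

lemma size_enc_drop: "size (enc (drop i xs)) \<le> size (enc xs)"
  using size_enc_append[of "take i xs" "drop i xs"] by simp

text \<open>Cells move one by one from one stack to another. Recursion on lists builds on this,
  because its loop starts at the opposite end.\<close>

lemma ptime_rev [ptime_intros]: "ptime f \<Longrightarrow> ptime (\<lambda>x. rev (f x))"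
proof (erule ptime_comp[where f = rev, rotated])
  let ?st = "\<lambda>(xs :: 'b list) i. (drop i xs, rev (take i xs))"
  let ?step = "\<lambda>z :: 'b list \<times> 'b list.
    case fst z of [] \<Rightarrow> z | y # ys \<Rightarrow> (ys, y # snd z)"
  have "ptime (\<lambda>xs. ?st xs (length xs))"
  proof (rule ptime_while[where st = ?st and b = "\<lambda>z. case fst z of [] \<Rightarrow> False | y # ys \<Rightarrow> True"
        and step = ?step and q = "[:1, 2:]" and r = "[:0, 1:]"])
    fix xs :: "'b list" and i
    show "size (enc (?st xs i)) \<le> poly [:1, 2:] (size (enc xs))"
      using size_enc_take[of i xs] size_enc_drop[of i xs] by (simp add: size_enc_rev)
  qed (auto intro!: ptime_intros simp: length_le_size_enc take_Suc_conv_app_nth simp flip: Cons_nth_drop_Suc)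
  then have "ptime (\<lambda>xs. snd (?st xs (length xs)))" by (rule ptime_snd)
  then show "ptime (rev :: 'b list \<Rightarrow> 'b list)" by simp
qed

text \<open>Bounded recursion on notation in the sense of Cobham: the recursion must not produce values
  of superpolynomial size.\<close>

lemma ptime_rec:
  fixes h :: "'e::enc \<Rightarrow> 'c::enc list \<Rightarrow> 'b::enc"
  assumes e: "ptime e" and xs: "ptime xs"
    and g: "ptime g"
    and f: "ptime (\<lambda>z. f (fst z) (fst (snd z)) (fst (snd (snd z))) (snd (snd (snd z))))"
    and h: "\<And>e. h e [] = g e" "\<And>e x xs. h e (x # xs) = f e x xs (h e xs)"
    and bound: "psize (\<lambda>z. h (fst z) (snd z))"
  shows "ptime (\<lambda>x. h (e x) (xs x))"
proof -
  \<comment> \<open>The loop reads the list from the front while \<open>h\<close> recurses from the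
    back. So the state holds \<open>h\<close> of the reversed prefix, and in the end the loop is
    applied to the reversed list.\<close>
  let ?st = "\<lambda>(z :: 'e \<times> 'c list) i.
    (fst z, drop i (snd z), rev (take i (snd z)), h (fst z) (rev (take i (snd z))))"
  let ?step = "\<lambda>z :: 'e \<times> 'c list \<times> 'c list \<times> 'b.
    case fst (snd z) of [] \<Rightarrow> z
    | y # ys \<Rightarrow> (fst z, ys, y # fst (snd (snd z)), f (fst z) y (fst (snd (snd z))) (snd (snd (snd z))))"
  obtain q where q: "\<And>e xs. size (enc (h e xs)) \<le> poly q (size (enc (e, xs)))"
    using bound unfolding psize_def by force
  have f': "ptime (\<lambda>z. f (e z) (y z) (ys z) (r z))"
    if "ptime e" "ptime y" "ptime ys" "ptime r" for e y ys r
  proof -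
    have "ptime (\<lambda>z. (e z, y z, ys z, r z))" using that by (intro ptime_intros)
    from ptime_comp[OF f this] show ?thesis by simp
  qed
  have "ptime (\<lambda>z. ?st z (length (snd z)))"
  proof (rule ptime_while[where st = ?st and
        b = "\<lambda>z. case fst (snd z) of [] \<Rightarrow> False | y # ys \<Rightarrow> True"
        and step = ?step and q = "[:4, 3:] + q" and r = "[:0, 1:]"])
    show "ptime (\<lambda>z. ?st z 0)"
      by (simp add: h) (intro ptime_intros ptime_comp[OF g])
    show "ptime ?step" by (intro ptime_intros f')
  next
    fix z :: "'e \<times> 'c list" and i
    assume "i \<le> length (snd z)"
    obtain e xs where z: "z = (e, xs)" by (cases z)
    have "size (enc (h e (rev (take i xs)))) \<le> poly q (size (enc (e, xs)))"
      by (rule order_trans[OF q poly_nat_mono]) (simp add: size_enc_rev size_enc_take)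
    then show "size (enc (?st z i)) \<le> poly ([:4, 3:] + q) (size (enc z))"
      using size_enc_take[of i xs] size_enc_drop[of i xs] by (simp add: z size_enc_rev)
  next
    fix z :: "'e \<times> 'c list"
    show "length (snd z) \<le> poly [:0, 1:] (size (enc z))"
      using length_le_size_enc[of "snd z"] by (cases z) simp
  next
    fix z :: "'e \<times> 'c list" and i
    assume "i < length (snd z)"
    then show "(case fst (snd (?st z i)) of [] \<Rightarrow> False | y # ys \<Rightarrow> True)
        \<and> ?step (?st z i) = ?st z (Suc i)"
      by (auto simp: h take_Suc_conv_app_nth simp flip: Cons_nth_drop_Suc)
  qed (auto intro!: ptime_intros)
  then have "ptime (\<lambda>z. snd (snd (snd (?st z (length (snd z))))))" by (intro ptime_snd)
  then have "ptime (\<lambda>z. h (fst z) (rev (snd z)))" by simp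
  moreover have "ptime (\<lambda>x. (e x, rev (xs x)))"
    by (intro ptime_intros e xs)
  ultimately have "ptime (\<lambda>x. h (fst (e x, rev (xs x))) (rev (snd (e x, rev (xs x)))))"
    by (rule ptime_comp)
  then show ?thesis by simp
qed

section \<open>Polynomial-time list operations\<close>

lemma size_enc_le: "(\<And>x. x \<in> set xs \<Longrightarrow> size (enc x) \<le> b) \<Longrightarrow> size (enc xs) \<le> length xs * Suc b"
proof (induction xs)
  case (Cons x xs)
  have "size (enc x) \<le> b" "size (enc xs) \<le> length xs * Suc b" using Cons by auto
  then show ?case by simp
qed simp

lemma size_enc_mem: "x \<in> set xs \<Longrightarrow> size (enc x) < size (enc xs)"
  by (induction xs) auto

lemma size_enc_filter: "size (enc (filter P xs)) \<le> size (enc xs)"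
  by (induction xs) auto

lemma size_enc_bool: "size (enc (b :: bool)) \<le> 1"
  by (cases b) auto

lemma psize_bool: "psize (f :: 'a::enc \<Rightarrow> bool)"
  by (rule psizeI[where q = 1]) (simp add: size_enc_bool[simplified])

lemma ptime_map [ptime_intros]:
  assumes f: "ptime (\<lambda>z. f (fst z) (snd z))" and xs: "ptime xs"
  shows "ptime (\<lambda>x. map (\<lambda>y. f x y) (xs x))"
proof (rule ptime_rec[where f = "\<lambda>x y ys r. f x y # r" and h = "\<lambda>x. map (f x)"
      and g = "\<lambda>x. []" and e = "\<lambda>x. x"])
  obtain q where q: "\<And>z. size (enc (f (fst z) (snd z))) \<le> poly q (size (enc z))"
    using ptime_psize[OF f] unfolding psize_def by blast
  show "psize (\<lambda>z. map (f (fst z)) (snd z))"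
  proof (rule psizeI[where q = "[:0, 1:] * (1 + q)"])
    fix z :: "'a \<times> 'b list"
    obtain x ys where z: "z = (x, ys)" by (cases z)
    have "size (enc (f x y)) \<le> poly q (size (enc z))" if "y \<in> set ys" for y
      by (rule order_trans[OF q[of "(x, y)", simplified] poly_nat_mono])
        (use size_enc_mem[OF that] in \<open>simp add: z\<close>)
    then have "size (enc (map (f x) ys)) \<le> length (map (f x) ys) * Suc (poly q (size (enc z)))"
      by (intro size_enc_le) auto
    also have "\<dots> \<le> size (enc z) * Suc (poly q (size (enc z)))"
      using length_le_size_enc[of ys] by (intro mult_right_mono) (auto simp: z)
    finally show "size (enc (map (f (fst z)) (snd z))) \<le> poly ([:0, 1:] * (1 + q)) (size (enc z))"
      by (simp add: z)
  qed
qed (intro ptime_intros ptime_comp2[OF f] xs | simp)+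

lemma ptime_filter [ptime_intros]:
  assumes P: "ptime (\<lambda>z. P (fst z) (snd z))" and xs: "ptime xs"
  shows "ptime (\<lambda>x. filter (\<lambda>y. P x y) (xs x))"
proof (rule ptime_rec[where f = "\<lambda>x y ys r. if P x y then y # r else r" and h = "\<lambda>x. filter (P x)"
      and g = "\<lambda>x. []" and e = "\<lambda>x. x"])
  show "psize (\<lambda>z. filter (P (fst z)) (snd z))"
    by (rule psizeI[where q = "[:0, 1:]"])
      (auto simp: size_enc_filter le_SucI trans_le_add2)
qed (intro ptime_intros ptime_comp2[OF P] xs | simp)+

lemma ptime_Bex [ptime_intros]:
  assumes P: "ptime (\<lambda>z. P (fst z) (snd z))" and xs: "ptime xs"
  shows "ptime (\<lambda>x. \<exists>y \<in> set (xs x). P x y)"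
  by (rule ptime_rec[where f = "\<lambda>x y ys r. P x y \<or> r" and h = "\<lambda>x ys. \<exists>y \<in> set ys. P x y"
      and g = "\<lambda>x. False" and e = "\<lambda>x. x"])
    (intro ptime_intros ptime_comp2[OF P] xs psize_bool | simp)+

text \<open>Equality of elements is a premise, since \<open>enc\<close> need not be injective and
  equality cannot in general be read off the codes.\<close>

lemma ptime_member [ptime_intros]:
  fixes f :: "'a::enc \<Rightarrow> 'b::enc"
  assumes eq: "ptime (\<lambda>z :: 'b \<times> 'b. fst z = snd z)" and f: "ptime f" and xs: "ptime xs"
  shows "ptime (\<lambda>x. f x \<in> set (xs x))"
proof -
  have "ptime (\<lambda>x. \<exists>y \<in> set (xs x). f x = y)"
    by (intro ptime_Bex ptime_comp2[where f = "(=)", OF eq] ptime_comp[OF f] ptime_intros xs)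
  then show ?thesis by simp
qed

lemma ptime_append [ptime_intros]:
  assumes "ptime f" "ptime g"
  shows "ptime (\<lambda>x. f x @ g x)"
proof (rule ptime_rec[where f = "\<lambda>e y ys r. y # r" and h = "\<lambda>e ys. ys @ e"
      and g = "\<lambda>e. e" and e = g])
  show "psize (\<lambda>z. snd z @ fst z)"
    by (rule psizeI[where q = "[:0, 1:]"]) (auto simp: size_enc_append)
qed (intro ptime_intros assms | simp)+

lemma size_enc_concat: "size (enc (concat xss)) \<le> size (enc xss)"
  by (induction xss) (auto simp: size_enc_append)

lemma ptime_concat [ptime_intros]:
  assumes "ptime f"
  shows "ptime (\<lambda>x. concat (f x))"
proof (rule ptime_rec[where f = "\<lambda>e y ys r. y @ r" and h = "\<lambda>e. concat"
      and g = "\<lambda>e. []" and e = "\<lambda>x. x"])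
  show "psize (\<lambda>z. concat (snd z))"
    by (rule psizeI[where q = "[:0, 1:]"]) (auto intro: order_trans[OF size_enc_concat])
qed (intro ptime_intros assms | simp)+

section \<open>Arithmetic on binary digits\<close>

fun bits :: "nat \<Rightarrow> bool list" where
  "bits n = (if n = 0 then [] else odd n # bits (n div 2))"

declare bits.simps [simp del]

text \<open>A digit has the code of a Boolean, so arithmetic becomes recursion on lists of Booleans
  without any conversion.\<close>

lemma enc_bits: "enc (bits n) = enc n"
proof (induction n rule: bits.induct)
  case (1 n)
  then show ?case
    by (subst bits.simps, unfold nat_enc, subst enc_nat.simps)
      (auto simp: nat_enc)
qed

lemma bits_inject: "bits m = bits n \<longleftrightarrow> m = n"
  by (metis enc_bits nat_enc enc_nat_inject)

lemma ptime_bits: "ptime f \<Longrightarrow> ptime (\<lambda>x. bits (f x))"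
  by (rule ptime_recode) (simp_all add: enc_bits)

lemma ptime_unbits: "ptime (\<lambda>x. bits (f x)) \<Longrightarrow> ptime f"
  by (erule ptime_recode) (simp add: enc_bits)

primrec inc :: "bool list \<Rightarrow> bool list" where
  "inc [] = [True]"
| "inc (b # bs) = (if b then False # inc bs else True # bs)"

lemma bits_Suc: "bits (Suc n) = inc (bits n)"
proof (induction n rule: bits.induct)
  case (1 n)
  show ?case
  proof (cases "n = 0")
    case True
    then show ?thesis by (simp add: bits.simps)
  next
    case False
    then show ?thesis
      using 1[OF False] bits.simps[of n] bits.simps[of "Suc n"] by (cases "odd n") auto
  qed
qed

lemma ptime_Suc [ptime_intros]:
  assumes "ptime f"
  shows "ptime (\<lambda>x. Suc (f x))"
proof (rule ptime_unbits)
  have "ptime (\<lambda>x. inc (bits (f x)))"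
  proof (rule ptime_rec[where f = "\<lambda>e b bs r. if b then False # r else True # bs" and h = "\<lambda>e. inc"
        and g = "\<lambda>e. [True]" and e = "\<lambda>x. x"])
    \<comment> \<open>The bound is attained at the empty list, where a cell of size 2 with the new
      leading digit arises.\<close>
    have "size (enc (inc bs)) \<le> size (enc bs) + 2" for bs
      by (induction bs) auto
    from order_trans[OF this] show "psize (\<lambda>z. inc (snd z))"
      by (intro psizeI[where q = "[:2, 1:]"]) auto
  qed (intro ptime_intros ptime_bits assms | simp)+
  then show "ptime (\<lambda>x. bits (Suc (f x)))" by (simp add: bits_Suc)
qed

text \<open>The recursion consumes the reverse of the other list from the innermost call outwards.\<close>

primrec strip :: "bool list \<Rightarrow> bool list \<Rightarrow> bool list option" where
  "strip ys [] = Some (rev ys)"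
| "strip ys (x # xs) =
    (case strip ys xs of None \<Rightarrow> None
     | Some r \<Rightarrow> (case r of [] \<Rightarrow> None | z # zs \<Rightarrow> if x \<longleftrightarrow> z then Some zs else None))"

lemma strip_eq_Some: "strip ys xs = Some r \<longleftrightarrow> rev ys = rev xs @ r"
proof (induction xs arbitrary: r)
  case (Cons x xs)
  show ?case
    using Cons.IH[of "x # r"] by (cases "strip ys xs") (auto split: list.split)
qed simp

text \<open>Recursion runs along one digit list; the other is a parameter consumed by
  \<open>strip\<close>. The numbers are equal iff \<open>strip\<close> succeeds and leaves
  nothing.\<close>

lemma ptime_eq_nat [ptime_intros]:
  fixes f g :: "'a::enc \<Rightarrow> nat"
  assumes "ptime f" "ptime g"
  shows "ptime (\<lambda>x. f x = g x)"
proof -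
  \<comment> \<open>\<open>x \<longleftrightarrow> z\<close> is spelled out by connectives for which
    closure rules are at hand.\<close>
  let ?step = "\<lambda>(e :: bool list) x (xs :: bool list) (r :: bool list option).
    case r of None \<Rightarrow> None
    | Some r \<Rightarrow> (case r of [] \<Rightarrow> None | z # zs \<Rightarrow> if (x \<and> z) \<or> (\<not> x \<and> \<not> z) then Some zs else None)"
  have "ptime (\<lambda>x. strip (bits (f x)) (bits (g x)))"
  proof (rule ptime_rec[where f = ?step and h = strip and g = "\<lambda>e. Some (rev e)"])
    have "size (enc (strip ys xs)) \<le> size (enc ys) + 1" for xs ys
    proof (cases "strip ys xs")
      case (Some r)
      then have "size (enc (rev ys)) = size (enc (rev xs @ r))" by (simp add: strip_eq_Some)
      then show ?thesis using Some by (simp add: size_enc_append size_enc_rev)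
    qed simp
    from order_trans[OF this] show "psize (\<lambda>z. strip (fst z) (snd z))"
      by (intro psizeI[where q = "[:1, 1:]"]) auto
  qed (intro ptime_intros ptime_bits assms | simp split: option.split list.split)+
  then have "ptime (\<lambda>x. case strip (bits (f x)) (bits (g x)) of None \<Rightarrow> False
      | Some r \<Rightarrow> (case r of [] \<Rightarrow> True | z # zs \<Rightarrow> False))"
    by (intro ptime_intros)
  moreover have "(case strip ys xs of None \<Rightarrow> False
      | Some r \<Rightarrow> (case r of [] \<Rightarrow> True | z # zs \<Rightarrow> False)) \<longleftrightarrow> strip ys xs = Some []" for ys xs
    by (auto split: option.split list.split)
  ultimately show ?thesis by (simp add: strip_eq_Some bits_inject)
qed

lemma ptime_eq_prod [ptime_intros]:
  fixes f g :: "'a::enc \<Rightarrow> 'b::enc \<times> 'c::enc"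
  assumes "ptime (\<lambda>z :: 'b \<times> 'b. fst z = snd z)" "ptime (\<lambda>z :: 'c \<times> 'c. fst z = snd z)"
    and "ptime f" "ptime g"
  shows "ptime (\<lambda>x. f x = g x)"
proof -
  have "ptime (\<lambda>x. fst (f x) = fst (g x) \<and> snd (f x) = snd (g x))"
    by (intro ptime_conj ptime_comp2[where f = "(=)", OF assms(1)] ptime_comp2[where f = "(=)", OF assms(2)] ptime_intros assms(3,4))
  then show ?thesis by (simp add: prod_eq_iff)
qed

text \<open>A bound linear in the value suffices, as the numbers produced are lengths of lists and
  positions in them.\<close>

lemma size_enc_nat: "size (enc (n :: nat)) \<le> 2 * n"
proof (induction n rule: less_induct)
  case (less n)
  show ?case
  proof (cases "n = 0")
    case False
    then have "size (enc (n div 2)) \<le> 2 * (n div 2)" using less by simp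
    then show ?thesis
      using False by (cases "n = 1") (auto simp: nat_enc enc_nat.simps[of n] enc_nat.simps[of 0] enc_nat.simps[of "Suc 0"])
  qed (simp add: nat_enc enc_nat.simps)
qed

lemma ptime_length [ptime_intros]:
  assumes "ptime f"
  shows "ptime (\<lambda>x. length (f x))"
proof (rule ptime_rec[where f = "\<lambda>e y ys r. Suc r" and h = "\<lambda>e. length"
      and g = "\<lambda>e. 0" and e = "\<lambda>x. x"])
  show "psize (\<lambda>z :: 'a \<times> 'b list. length (snd z))"
  proof (rule psizeI[where q = "[:0, 2:]"])
    fix z :: "'a \<times> 'b list"
    show "size (enc (length (snd z))) \<le> poly [:0, 2:] (size (enc z))"
      using size_enc_nat[of "length (snd z)"] length_le_size_enc[of "snd z"] by (cases z) simp
  qed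
qed (intro ptime_intros assms | simp)+

text \<open>The range runs along a list; up to a number given in binary it could be exponentially
  long.\<close>

lemma ptime_upt_length [ptime_intros]:
  assumes "ptime f"
  shows "ptime (\<lambda>x. [0..<length (f x)])"
proof (rule ptime_rec[where f = "\<lambda>e y ys r. r @ [length ys]" and h = "\<lambda>e ys. [0..<length ys]"
      and g = "\<lambda>e. []" and e = "\<lambda>x. x"])
  show "psize (\<lambda>z :: 'a \<times> 'b list. [0..<length (snd z)])"
  proof (rule psizeI[where q = "[:0, 1:] * (1 + [:0, 2:])"])
    fix z :: "'a \<times> 'b list"
    have len: "length (snd z) \<le> size (enc z)"
      using length_le_size_enc[of "snd z"] by (cases z) simp
    have "size (enc k) \<le> 2 * size (enc z)" if "k < length (snd z)" for k :: nat
      using size_enc_nat[of k] that len by linarith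
    then have "size (enc [0..<length (snd z)]) \<le> length [0..<length (snd z)] * Suc (2 * size (enc z))"
      by (intro size_enc_le) auto
    also have "\<dots> \<le> size (enc z) * Suc (2 * size (enc z))"
      using len by (intro mult_right_mono) auto
    finally show "size (enc [0..<length (snd z)]) \<le> poly ([:0, 1:] * (1 + [:0, 2:])) (size (enc z))"
      by (simp add: algebra_simps)
  qed
qed (intro ptime_intros assms | simp)+

section \<open>Minimum cuts by path reversal\<close>

definition cut :: "'n set \<Rightarrow> ('n \<times> 'n) list \<Rightarrow> nat" where
  "cut X as = length (filter (\<lambda>(u, v). u \<in> X \<and> v \<notin> X) as)"

lemma cut_Nil [simp]: "cut X [] = 0"
  and cut_Cons [simp]: "cut X (a # as) = (if fst a \<in> X \<and> snd a \<notin> X then 1 else 0) + cut X as"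
  and cut_append [simp]: "cut X (as @ bs) = cut X as + cut X bs"
  by (auto simp: cut_def)

lemma cut_le_length: "cut X as \<le> length as"
  by (simp add: cut_def)

text \<open>Arcs have unit capacity and parallel arcs add up, so residual graphs need to be known
  only up to the order of their arcs.\<close>

lemma cut_mset: "cut X as = size (filter_mset (\<lambda>(u, v). u \<in> X \<and> v \<notin> X) (mset as))"
  unfolding cut_def by (metis mset_filter size_mset)

lemma cut_eq_0_iff: "cut X as = 0 \<longleftrightarrow> (\<forall>(u, v) \<in> set as. u \<in> X \<longrightarrow> v \<in> X)"
  by (auto simp: cut_def filter_empty_conv)

primrec walk :: "'n \<Rightarrow> ('n \<times> 'n) list \<Rightarrow> 'n \<Rightarrow> bool" where
  "walk u [] v \<longleftrightarrow> u = v"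
| "walk u (a # as) v \<longleftrightarrow> fst a = u \<and> walk (snd a) as v"

lemma walk_append: "walk u (as @ bs) w \<longleftrightarrow> (\<exists>v. walk u as v \<and> walk v bs w)"
  by (induction as arbitrary: u) auto

text \<open>A walk leaves and enters \<open>X\<close> alternately, so exits and entries differ only
  according to its ends. The entries are the cut arcs of the reversed walk.\<close>

lemma cut_walk:
  "walk u p v \<Longrightarrow>
    cut X p + (if v \<in> X then 1 else 0) = cut X (map prod.swap p) + (if u \<in> X then 1 else 0)"
proof (induction p arbitrary: u)
  case (Cons a p)
  show ?case using Cons.IH[of "snd a"] Cons.prems by (auto split: if_splits)
qed simp

primrec removes :: "'a list \<Rightarrow> 'a list \<Rightarrow> 'a list" where
  "removes as [] = as"
| "removes as (b # bs) = remove1 b (removes as bs)"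

lemma mset_removes: "mset (removes as bs) = mset as - mset bs"
  by (induction bs) auto

section \<open>Forest of the nodes reachable from the sources\<close>

definition reached :: "'n list \<Rightarrow> ('n \<times> 'n) list \<Rightarrow> 'n list" where
  "reached ss T = ss @ map snd T"

definition add :: "'n list \<Rightarrow> 'n \<times> 'n \<Rightarrow> ('n \<times> 'n) list \<Rightarrow> ('n \<times> 'n) list" where
  "add ss a T =
    (if fst a \<in> set (reached ss T) \<and> snd a \<notin> set (reached ss T) then T @ [a] else T)"

primrec scan :: "'n list \<Rightarrow> ('n \<times> 'n) list \<Rightarrow> ('n \<times> 'n) list \<Rightarrow> ('n \<times> 'n) list" where
  "scan ss T [] = T"
| "scan ss T (a # as) = add ss a (scan ss T as)"

text \<open>The last list only counts the passes in unary, a form to which \<open>ptime_rec\<close>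
  applies.\<close>

primrec scans :: "'n list \<Rightarrow> ('n \<times> 'n) list \<Rightarrow> 'b list \<Rightarrow> ('n \<times> 'n) list" where
  "scans ss as [] = []"
| "scans ss as (b # bs) = scan ss (scans ss as bs) as"

definition search :: "'n list \<Rightarrow> ('n \<times> 'n) list \<Rightarrow> ('n \<times> 'n) list" where
  "search ss as = scans ss as as"

text \<open>The heads of the arcs are distinct and outside \<open>ss\<close>, so every reached node
  has a unique way back to a root.\<close>

inductive forest :: "'n list \<Rightarrow> ('n \<times> 'n) list \<Rightarrow> bool" for ss where
  Nil: "forest ss []"
| snoc: "forest ss T \<Longrightarrow> fst a \<in> set (reached ss T) \<Longrightarrow> snd a \<notin> set (reached ss T)
    \<Longrightarrow> forest ss (T @ [a])"

lemma forest_scan: "forest ss T \<Longrightarrow> forest ss (scan ss T as)"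
  by (induction as) (auto simp: add_def intro: forest.snoc)

lemma forest_scans: "forest ss (scans ss as bs)"
  by (induction bs) (auto intro: forest_scan forest.Nil)

lemma forest_distinct: "forest ss T \<Longrightarrow> distinct T"
  by (induction rule: forest.induct) (force simp: reached_def)+

lemma set_scan: "set (scan ss T as) \<subseteq> set T \<union> set as"
  by (induction as) (auto simp: add_def)

lemma set_scans: "set (scans ss as bs) \<subseteq> set as"
  by (induction bs) (use set_scan in fastforce)+

lemma scan_extends: "\<exists>S. scan ss T as = T @ S"
  by (induction as) (auto simp: add_def)

text \<open>A pass only appends arcs, so one that returns \<open>T\<close> has tested every arc
  against \<open>T\<close> itself.\<close>

lemma scan_fixpoint:
  assumes "scan ss T as = T" "(u, v) \<in> set as" "u \<in> set (reached ss T)"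
  shows "v \<in> set (reached ss T)"
  using assms
proof (induction as)
  case (Cons a as)
  obtain S where S: "scan ss T as = T @ S" using scan_extends by blast
  then have "scan ss T as = T" and "add ss a T = T"
    using Cons.prems(1) by (auto simp: add_def split: if_splits)
  then show ?case using Cons by (auto simp: add_def split: if_splits)
qed simp

text \<open>After a pass without effect all further passes have none. So if the next pass still adds
  an arc, every earlier one did.\<close>

lemma length_scans: "scan ss (scans ss as bs) as \<noteq> scans ss as bs \<Longrightarrow> length bs \<le> length (scans ss as bs)"
proof (induction bs)
  case (Cons b bs)
  let ?T = "scans ss as bs"
  have "scan ss ?T as \<noteq> ?T" using Cons.prems by auto
  moreover obtain S where "scan ss ?T as = ?T @ S" using scan_extends by blast
  ultimately show ?case using Cons.IH by (cases S) auto
qed simp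

text \<open>Otherwise \<open>length as\<close> passes and one more would each have added an arc, but
  a forest consists of distinct arcs of \<open>as\<close>.\<close>

lemma search_fixpoint: "scan ss (search ss as) as = search ss as"
proof (rule ccontr)
  let ?T = "search ss as"
  assume "scan ss ?T as \<noteq> ?T"
  moreover obtain S where S: "scan ss ?T as = ?T @ S" using scan_extends by blast
  ultimately have "length as < length (scan ss ?T as)"
    using length_scans[of ss as as] by (cases S) (auto simp: search_def)
  moreover have "length (scan ss ?T as) \<le> length as"
  proof -
    have "distinct (scan ss ?T as)"
      unfolding search_def by (intro forest_distinct[of ss] forest_scan forest_scans)
    moreover have "set (scan ss ?T as) \<subseteq> set as"
      using set_scan set_scans unfolding search_def by fastforce
    ultimately show ?thesis
      by (metis card_length card_mono distinct_card finite_set le_trans)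
  qed
  ultimately show False by simp
qed

text \<open>Arcs are appended to the forest, so tracing a node back to its root visits them from the last
  to the first.\<close>

primrec trace :: "'n \<Rightarrow> ('n \<times> 'n) list \<Rightarrow> 'n \<times> ('n \<times> 'n) list" where
  "trace v [] = (v, [])"
| "trace v (a # T) = (let (w, p) = trace v T in if snd a = w then (fst a, a # p) else (w, p))"

text \<open>Forests grow at the end while \<open>trace\<close> recurses from the front; this
  equation fits the induction over \<open>forest\<close>.\<close>

lemma trace_snoc:
  "trace v (T @ [a]) =
    (if snd a = v then (fst (trace (fst a) T), snd (trace (fst a) T) @ [a]) else trace v T)"
  by (induction T) (auto simp: Let_def split: prod.splits)

lemma set_trace: "set (snd (trace v T)) \<subseteq> set T"
  by (induction T) (auto simp: Let_def split: prod.splits)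

lemma trace_forest:
  assumes "forest ss T" "v \<in> set (reached ss T)"
  shows "fst (trace v T) \<in> set ss \<and> walk (fst (trace v T)) (snd (trace v T)) v
    \<and> distinct (snd (trace v T))"
  using assms
proof (induction arbitrary: v rule: forest.induct)
  case (snoc T a)
  \<comment> \<open>The head of \<open>a\<close> is not reached by \<open>T\<close>, so no path
    traced in \<open>T\<close> uses \<open>a\<close>.\<close>
  have "a \<notin> set (snd (trace w T))" for w
    using set_trace[of w T] snoc.hyps(3) by (force simp: reached_def)
  then show ?case
    using snoc.IH[of v] snoc.IH[of "fst a"] snoc.prems snoc.hyps(2)
    by (auto simp: trace_snoc walk_append reached_def)
qed (simp add: reached_def)

section \<open>Residual graphs and augmenting paths\<close>

definition flip_path :: "('n \<times> 'n) list \<Rightarrow> ('n \<times> 'n) list \<Rightarrow> ('n \<times> 'n) list" where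
  "flip_path p as = map prod.swap p @ removes as p"

text \<open>One round of the Ford-Fulkerson method, sending a unit of flow to the first sink
  found.\<close>

definition augment :: "'n list \<Rightarrow> 'n list \<Rightarrow> ('n \<times> 'n) list \<Rightarrow> ('n \<times> 'n) list" where
  "augment ss ts as =
    (let T = search ss as in
     case filter (\<lambda>v. v \<in> set ts) (map snd T) of [] \<Rightarrow> as | v # vs \<Rightarrow> flip_path (snd (trace v T)) as)"

lemma augment_cases:
  obtains (stuck) "augment ss ts as = as" "set (map snd (search ss as)) \<inter> set ts = {}"
  | (path) p u v where "augment ss ts as = flip_path p as" "walk u p v" "u \<in> set ss" "v \<in> set ts"
      "mset p \<subseteq># mset as"
proof (cases "filter (\<lambda>v. v \<in> set ts) (map snd (search ss as))")
  case Nil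
  then show ?thesis by (intro stuck) (auto simp: augment_def filter_empty_conv)
next
  case (Cons v vs)
  let ?T = "search ss as"
  let ?p = "snd (trace v ?T)"
  have "v \<in> set (filter (\<lambda>v. v \<in> set ts) (map snd ?T))" using Cons by simp
  then have v: "v \<in> set ts" "v \<in> set (reached ss ?T)" by (auto simp: reached_def)
  have T: "forest ss ?T" by (simp add: search_def forest_scans)
  have "set ?p \<subseteq> set as"
    using set_trace[of v ?T] set_scans[of ss as as] by (auto simp: search_def)
  \<comment> \<open>Parallel arcs are equal as pairs; a path without repetition uses one copy at
    most, so inclusion of sets gives inclusion of multisets.\<close>
  moreover have "distinct ?p" using trace_forest[OF T v(2)] by simp
  ultimately have "mset ?p \<subseteq># mset as"
    by (intro mset_subset_eqI) (auto simp: distinct_count_atmost_1 Suc_le_eq)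
  then show ?thesis
    using trace_forest[OF T v(2)] v(1) Cons by (intro path[of ?p]) (auto simp: augment_def)
qed

lemma mset_flip_path:
  assumes "mset p \<subseteq># mset as"
  shows "mset (flip_path p as) + mset p = mset as + mset (map prod.swap p)"
proof -
  have "mset as - mset p + mset p = mset as"
    using assms by (rule subset_mset.diff_add)
  then show ?thesis
    by (simp only: flip_path_def mset_removes mset_append add.assoc) (rule add.commute)
qed

text \<open>Reversing a path of a residual graph lowers every cut between the sources and the sinks by
  exactly one. Hence the cuts keep their order, and one of residual value 0 is minimal.\<close>

lemma cut_flip_path:
  assumes "walk u p v" "u \<in> X" "v \<notin> X" "mset p \<subseteq># mset as"
  shows "Suc (cut X (flip_path p as)) = cut X as"
proof -
  have "mset (flip_path p as @ p) = mset (as @ map prod.swap p)"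
    using mset_flip_path[OF assms(4)] by simp
  then have "cut X (flip_path p as @ p) = cut X (as @ map prod.swap p)"
    by (simp only: cut_mset)
  then show ?thesis using cut_walk[OF assms(1), of X] assms(2,3) by simp
qed

primrec augments :: "'n list \<Rightarrow> 'n list \<Rightarrow> ('n \<times> 'n) list \<Rightarrow> 'b list \<Rightarrow> ('n \<times> 'n) list" where
  "augments ss ts as [] = as"
| "augments ss ts as (b # bs) = augment ss ts (augments ss ts as bs)"

text \<open>The source side is what can be reached in the final residual graph. The last
  \<open>as\<close> counts the rounds.\<close>

definition min_cut :: "'n list \<Rightarrow> 'n list \<Rightarrow> ('n \<times> 'n) list \<Rightarrow> 'n list" where
  "min_cut ss ts as = reached ss (search ss (augments ss ts as as))"

definition separates :: "'n list \<Rightarrow> 'n list \<Rightarrow> 'n set \<Rightarrow> bool" where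
  "separates ss ts X \<longleftrightarrow> set ss \<subseteq> X \<and> set ts \<inter> X = {}"

lemma cut_augment:
  assumes "separates ss ts X"
  shows "augment ss ts as = as \<or> Suc (cut X (augment ss ts as)) = cut X as"
proof (rule augment_cases[of ss ts as])
  fix p u v
  assume "augment ss ts as = flip_path p as" "walk u p v" "u \<in> set ss" "v \<in> set ts" "mset p \<subseteq># mset as"
  then show ?thesis using cut_flip_path[of u p v X as] assms by (auto simp: separates_def)
qed simp

text \<open>Reversing a path to a sink would change the cut of \<open>set ss\<close>, so at a
  fixpoint no sink is reached.\<close>

lemma augment_fixpoint:
  assumes "set ss \<inter> set ts = {}" "augment ss ts as = as"
  shows "separates ss ts (set (reached ss (search ss as)))"
proof (rule augment_cases[of ss ts as])
  fix p u v
  assume "augment ss ts as = flip_path p as" "walk u p v" "u \<in> set ss" "v \<in> set ts" "mset p \<subseteq># mset as"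
  then have "Suc (cut (set ss) as) = cut (set ss) as"
    using cut_flip_path[of u p v "set ss" as] assms by auto
  then show ?thesis by simp
qed (use assms in \<open>auto simp: separates_def reached_def\<close>)

text \<open>Each round lowers all separating cuts by the same amount. The invariance of their
  differences is stated with sums, to avoid subtraction of natural numbers.\<close>

lemma augments_diff:
  assumes X: "separates ss ts X" and Y: "separates ss ts Y"
  shows "cut X (augments ss ts as bs) + cut Y as = cut X as + cut Y (augments ss ts as bs)"
proof (induction bs)
  case (Cons b bs)
  show ?case
    using Cons.IH cut_augment[OF X, of "augments ss ts as bs"] cut_augment[OF Y, of "augments ss ts as bs"]
    by auto
qed simp

text \<open>The cut of \<open>X\<close> serves as a potential: it is at most
  \<open>length as\<close> in the beginning, and every effective round lowers it by one.\<close>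

lemma augments_fixpoint:
  assumes X: "separates ss ts X"
  shows "augment ss ts (augments ss ts as as) = augments ss ts as as"
proof (rule ccontr)
  let ?A = "augments ss ts as"
  assume "augment ss ts (?A as) \<noteq> ?A as"
  moreover have "cut X (?A bs) + length bs \<le> cut X as" if "augment ss ts (?A bs) \<noteq> ?A bs" for bs :: "('a \<times> 'a) list"
    using that
  proof (induction bs)
    case (Cons b bs)
    have "augment ss ts (?A bs) \<noteq> ?A bs" using Cons.prems by auto
    then show ?case using Cons.IH cut_augment[OF X, of "?A bs"] by auto
  qed simp
  ultimately have "cut X (?A as) + length as \<le> cut X as" "Suc (cut X (augment ss ts (?A as))) = cut X (?A as)"
    using cut_augment[OF X, of "?A as"] by auto
  then show False using cut_le_length[of X as] by simp
qed

lemma separates_min_cut: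
  assumes "set ss \<inter> set ts = {}"
  shows "separates ss ts (set (min_cut ss ts as))"
proof -
  have "separates ss ts (set ss)" using assms by (auto simp: separates_def)
  then show ?thesis
    unfolding min_cut_def by (intro augment_fixpoint augments_fixpoint assms)
qed

lemma min_cut_le:
  assumes X: "separates ss ts X"
  shows "cut (set (min_cut ss ts as)) as \<le> cut X as"
proof -
  let ?R = "set (min_cut ss ts as)" and ?bs = "augments ss ts as as"
  have "separates ss ts ?R"
    using X by (intro separates_min_cut) (auto simp: separates_def)
  then have "cut ?R ?bs + cut X as = cut ?R as + cut X ?bs"
    using X by (intro augments_diff)
  \<comment> \<open>The set reached by a completed search is closed under residual arcs.\<close>
  moreover have "cut ?R ?bs = 0"
    using scan_fixpoint[OF search_fixpoint] by (auto simp: cut_eq_0_iff min_cut_def)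
  ultimately show ?thesis by simp
qed

section \<open>Sorting by swaps\<close>

definition swp :: "nat \<Rightarrow> 'v list \<Rightarrow> 'v list" where
  "swp i l = l[i := l ! Suc i, Suc i := l ! i]"

lemma length_swp [simp]: "length (swp i l) = length l"
  by (simp add: swp_def)

lemma mset_swp: "Suc i < length l \<Longrightarrow> mset (swp i l) = mset l"
  unfolding swp_def using mset_swap[of "Suc i" l i] by (simp add: list_update_swap)

lemma swp_Suc [simp]: "swp (Suc i) (x # l) = x # swp i l"
  by (simp add: swp_def)

lemma fold_swp_Suc: "fold swp (map Suc is) (x # l) = x # fold swp is l"
  by (induction "is" arbitrary: l) auto

lemma swp_append: "swp (length xs) (xs @ x # y # ys) = xs @ y # x # ys"
proof (induction xs)
  case Nil
  show ?case by (simp add: swp_def)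
qed simp

lemma swp_split:
  assumes "Suc i < length l"
  obtains xs x y ys where "l = xs @ x # y # ys" "swp i l = xs @ y # x # ys"
proof
  show l: "l = take i l @ l ! i # l ! Suc i # drop (Suc (Suc i)) l"
    using assms by (simp add: Cons_nth_drop_Suc)
  have "swp (length (take i l)) (take i l @ l ! i # l ! Suc i # drop (Suc (Suc i)) l)
      = take i l @ l ! Suc i # l ! i # drop (Suc (Suc i)) l"
    by (rule swp_append)
  then show "swp i l = take i l @ l ! Suc i # l ! i # drop (Suc (Suc i)) l"
    using assms by (simp flip: l)
qed

section \<open>Inversions and sorting with the fewest swaps\<close>

primrec inversions :: "('v \<Rightarrow> bool) \<Rightarrow> 'v list \<Rightarrow> nat" where
  "inversions D [] = 0"
| "inversions D (x # xs) = (if D x then length (filter (\<lambda>y. \<not> D y) xs) else 0) + inversions D xs"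

lemma inversions_append:
  "inversions D (xs @ ys) =
    inversions D xs + inversions D ys + length (filter D xs) * length (filter (\<lambda>y. \<not> D y) ys)"
  by (induction xs) auto

text \<open>Only the exchanged pair changes its relative order.\<close>

lemma inversions_swp: "Suc i < length l \<Longrightarrow> inversions D l \<le> Suc (inversions D (swp i l))"
  by (erule swp_split) (simp add: inversions_append)

lemma inversions_eq_0:
  "(\<And>i j. i < j \<Longrightarrow> j < length l \<Longrightarrow> D (l ! i) \<Longrightarrow> D (l ! j)) \<Longrightarrow> inversions D l = 0"
proof (induction l)
  case (Cons x l)
  have "D y" if "D x" "y \<in> set l" for y
    using that Cons.prems[of 0] by (metis in_set_conv_nth length_Cons Suc_less_eq nth_Cons_0 nth_Cons_Suc zero_less_Suc)
  moreover have "inversions D l = 0"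
    using Cons.prems[of "Suc _" "Suc _"] by (intro Cons.IH) auto
  ultimately show ?case by (auto simp: filter_empty_conv)
qed simp

text \<open>Insertion sort: the tail is partitioned first, at positions shifted by one; then a head
  in \<open>D\<close> passes exactly the entries outside \<open>D\<close>, which now begin the tail.
  Each swap thus removes one inversion.\<close>

primrec partition_swaps :: "('v \<Rightarrow> bool) \<Rightarrow> 'v list \<Rightarrow> nat list" where
  "partition_swaps D [] = []"
| "partition_swaps D (x # xs) =
    map Suc (partition_swaps D xs) @ (if D x then [0..<length (filter (\<lambda>y. \<not> D y) xs)] else [])"

lemma length_partition_swaps: "length (partition_swaps D l) = inversions D l"
  by (induction l) auto

lemma partition_swaps_bound: "i \<in> set (partition_swaps D l) \<Longrightarrow> Suc i < length l"
proof (induction l arbitrary: i)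
  case (Cons x l)
  then show ?case
    using length_filter_le[of "\<lambda>y. \<not> D y" l] by (auto split: if_splits intro: less_le_trans)
qed simp

lemma fold_swp_upt: "fold swp [0..<length xs] (x # xs @ ys) = xs @ x # ys"
proof (induction xs arbitrary: x)
  case (Cons a xs)
  have "[0..<length (a # xs)] = 0 # map Suc [0..<length xs]"
    by (simp add: upt_conv_Cons map_Suc_upt del: upt_Suc)
  moreover have "swp 0 (x # a # xs @ ys) = a # x # xs @ ys" by (simp add: swp_def)
  ultimately show ?case using Cons by (simp add: fold_swp_Suc del: upt_Suc)
qed simp

lemma fold_partition_swaps:
  "fold swp (partition_swaps D l) l = filter (\<lambda>y. \<not> D y) l @ filter D l"
  by (induction l) (auto simp: fold_swp_Suc fold_swp_upt)

section \<open>Swap sequences on all lists\<close>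

lemma apply_swap_eq: "apply_swap (v, i) L = L(v := swp i (L v))"
  by (simp add: swp_def)

declare apply_swap.simps [simp del]

lemma fold_apply_swap_notin: "v \<notin> fst ` set \<sigma>s \<Longrightarrow> fold apply_swap \<sigma>s L v = L v"
  by (induction \<sigma>s arbitrary: L) (auto simp: apply_swap_eq)

lemma fold_apply_swap_Pair:
  "fold apply_swap (map (Pair v) is) L = L(v := fold swp is (L v))"
  by (induction "is" arbitrary: L) (auto simp: apply_swap_eq)

text \<open>A swap acts on one list, and among distinct vertices only the block of \<open>v\<close>
  acts on its list.\<close>

lemma fold_apply_swap_concat:
  assumes "distinct vs" "v \<in> set vs"
  shows "fold apply_swap (concat (map (\<lambda>v. map (Pair v) (f v)) vs)) L v = fold swp (f v) (L v)"
  using assms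
proof (induction vs arbitrary: L)
  case (Cons w vs)
  show ?case
  proof (cases "v = w")
    case True
    then have "v \<notin> fst ` set (concat (map (\<lambda>v. map (Pair v) (f v)) vs))"
      using Cons.prems by auto
    then show ?thesis
      using True by (simp add: fold_apply_swap_Pair fold_apply_swap_notin del: set_concat)
  next
    case False
    then show ?thesis using Cons by (auto simp: fold_apply_swap_Pair)
  qed
qed simp

lemma mset_fold_apply_swap:
  assumes "set \<sigma>s \<subseteq> {(v, i). Suc i < length (L v)}"
  shows "mset (fold apply_swap \<sigma>s L v) = mset (L v)"
  using assms
proof (induction \<sigma>s arbitrary: L)
  case (Cons \<sigma> \<sigma>s)
  obtain w i where \<sigma>: "\<sigma> = (w, i)" by (cases \<sigma>)
  show ?case
    using Cons.prems by (subst fold.simps, simp, subst Cons.IH) (auto simp: \<sigma> apply_swap_eq mset_swp)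
qed simp

text \<open>This is the lower bound on the number of swaps: each one lowers the total number of
  inversions by at most one, whatever sets \<open>D v\<close> are to be moved down.\<close>

lemma sum_inversions_le:
  assumes "finite V" "set \<sigma>s \<subseteq> {(v, i). Suc i < length (L v)}"
  shows "(\<Sum>v\<in>V. inversions (D v) (L v))
    \<le> length \<sigma>s + (\<Sum>v\<in>V. inversions (D v) (fold apply_swap \<sigma>s L v))"
  using assms(2)
proof (induction \<sigma>s arbitrary: L)
  case (Cons \<sigma> \<sigma>s)
  obtain w i where \<sigma>: "\<sigma> = (w, i)" by (cases \<sigma>)
  let ?L = "apply_swap \<sigma> L"
  have w: "inversions (D w) (L w) \<le> Suc (inversions (D w) (?L w))"
    using Cons.prems by (intro order_trans[OF inversions_swp]) (auto simp: \<sigma> apply_swap_eq)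
  have "(\<Sum>v\<in>V. inversions (D v) (L v)) \<le> (\<Sum>v\<in>V. (if v = w then 1 else 0) + inversions (D v) (?L v))"
    using w by (intro sum_mono) (auto simp: \<sigma> apply_swap_eq)
  also have "\<dots> \<le> Suc (\<Sum>v\<in>V. inversions (D v) (?L v))"
    using assms(1) by (simp add: sum.distrib)
  also have "\<dots> \<le> Suc (length \<sigma>s + (\<Sum>v\<in>V. inversions (D v) (fold apply_swap \<sigma>s ?L v)))"
    using Cons.prems by (subst Suc_le_mono, intro Cons.IH) (auto simp: \<sigma> apply_swap_eq)
  finally show ?case by simp
qed simp

section \<open>Reduction to a minimum cut\<close>

definition saturated :: "('v \<times> 'v) list \<Rightarrow> 'v \<Rightarrow> nat \<Rightarrow> bool" where
  "saturated Ss v c \<longleftrightarrow> length (filter (\<lambda>e. fst e = v \<or> snd e = v) Ss) = c"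

text \<open>Node \<open>(v, u)\<close> stands for the occurrence of \<open>u\<close> in the list of \<open>v\<close>. It belongs to the
  source side of a cut iff \<open>u\<close> is moved down, for \<open>v \<in> A\<close>, or is not moved down, for \<open>v \<in> B\<close>.
  With this choice, "\<open>b\<close> moves down at \<open>a\<close> or \<open>a\<close> moves down at \<open>b\<close>" says that the arc from
  \<open>(b, a)\<close> to \<open>(a, b)\<close> is not cut.\<close>

definition sinks :: "('v \<times> nat \<times> 'v list) list \<Rightarrow> ('v \<times> 'v) list \<Rightarrow> ('v \<times> 'v) list" where
  "sinks As Ss = concat (map (\<lambda>(v, c, l).
     filter (\<lambda>e. \<not> saturated Ss v c \<or> e \<in> set Ss) (map (\<lambda>u. (v, u)) l)) As)"

text \<open>Nothing may move down at an unsaturated vertex, and a partner never may. For side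
  \<open>B\<close> the complement makes such entries sources instead of sinks.\<close>

definition sources :: "('v \<times> nat \<times> 'v list) list \<Rightarrow> ('v \<times> 'v) list \<Rightarrow> ('v \<times> 'v) list" where
  "sources Bs Ss = concat (map (\<lambda>(v, c, l).
     filter (\<lambda>e. \<not> saturated Ss v c \<or> (snd e, fst e) \<in> set Ss) (map (\<lambda>u. (v, u)) l)) Bs)"

primrec ordered_pairs :: "'v list \<Rightarrow> ('v \<times> 'v) list" where
  "ordered_pairs [] = []"
| "ordered_pairs (x # xs) = map (\<lambda>y. (x, y)) xs @ ordered_pairs xs"

text \<open>Every pair in list order gives a unit arc, directed so that it is cut iff the first
  entry moves down and the second does not; complementation reverses it for side
  \<open>B\<close>.\<close>

definition costs :: "('v \<times> nat \<times> 'v list) list \<Rightarrow> ('v \<times> nat \<times> 'v list) list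
    \<Rightarrow> (('v \<times> 'v) \<times> ('v \<times> 'v)) list" where
  "costs As Bs =
     concat (map (\<lambda>(v, c, l). map (\<lambda>(x, y). ((v, x), (v, y))) (ordered_pairs l)) As) @
     concat (map (\<lambda>(v, c, l). map (\<lambda>(x, y). ((v, y), (v, x))) (ordered_pairs l)) Bs)"

definition forced :: "('v \<times> 'v) list \<Rightarrow> ('v \<times> 'v) list \<Rightarrow> (('v \<times> 'v) \<times> ('v \<times> 'v)) list" where
  "forced Es Ss = map (\<lambda>e. ((snd e, fst e), e)) (filter (\<lambda>e. e \<notin> set Ss) Es)"

text \<open>The copies make one arc of \<open>fs\<close> dearer than all arcs of \<open>us\<close> together.\<close>

definition amplify :: "'a list \<Rightarrow> 'a list \<Rightarrow> 'a list" where
  "amplify us fs = us @ fs @ concat (map (\<lambda>u. fs) us)"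

text \<open>The argument is nested like the input tree, so that both have the same code. A forced
  arc from a source to a sink is the only obstruction to a solution.\<close>

definition solve :: "(('v \<times> nat \<times> 'v list) list \<times> ('v \<times> nat \<times> 'v list) list)
    \<times> ('v \<times> 'v) list \<times> ('v \<times> 'v) list \<Rightarrow> ('v \<times> nat) list option" where
  "solve z = (case z of ((As, Bs), (Es, Ss)) \<Rightarrow>
     let ss = sources Bs Ss; ts = sinks As Ss; fs = forced Es Ss in
     if \<exists>f \<in> set fs. fst f \<in> set ss \<and> snd f \<in> set ts then None
     else
       let R = min_cut ss ts (amplify (costs As Bs) fs) in
       Some (concat (map (\<lambda>(v, c, l). map (\<lambda>i. (v, i)) (partition_swaps (\<lambda>u. (v, u) \<in> set R) l)) As) @
         concat (map (\<lambda>(v, c, l). map (\<lambda>i. (v, i)) (partition_swaps (\<lambda>u. (v, u) \<notin> set R) l)) Bs)))"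

section \<open>Values of cuts in the network\<close>

lemma cut_concat: "cut X (concat xss) = (\<Sum>xs\<leftarrow>xss. cut X xs)"
  by (induction xss) auto

lemma cut_amplify: "cut X (amplify us fs) = cut X us + Suc (length us) * cut X fs"
  by (simp add: amplify_def cut_concat comp_def sum_list_triv)

lemma cut_pairs_out: "cut X (map (\<lambda>y. ((v, x), (v, y))) l)
    = (if (v, x) \<in> X then length (filter (\<lambda>y. (v, y) \<notin> X) l) else 0)"
  by (induction l) auto

lemma cut_pairs_in: "cut X (map (\<lambda>y. ((v, y), (v, x))) l)
    = (if (v, x) \<notin> X then length (filter (\<lambda>y. (v, y) \<in> X) l) else 0)"
  by (induction l) auto

lemma cut_costs_out: "cut X (map (\<lambda>(x, y). ((v, x), (v, y))) (ordered_pairs l))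
    = inversions (\<lambda>u. (v, u) \<in> X) l"
  by (induction l) (auto simp: cut_pairs_out comp_def)

lemma cut_costs_in: "cut X (map (\<lambda>(x, y). ((v, y), (v, x))) (ordered_pairs l))
    = inversions (\<lambda>u. (v, u) \<notin> X) l"
  by (induction l) (auto simp: cut_pairs_in comp_def)

section \<open>Instances with their sets listed in any order\<close>

locale smp_input =
  fixes I :: "'v smp" and S :: "('v \<times> 'v) set" and As Bs :: "'v list" and Es Ss :: "('v \<times> 'v) list"
  assumes inst: "smp_instance I" and S_edges: "S \<subseteq> edges I"
    and degree_le: "\<And>v. v \<in> verts I \<Longrightarrow> degree_in S v \<le> cap I v"
    and As: "distinct As" "set As = sideA I" and Bs: "distinct Bs" "set Bs = sideB I"
    and Es: "set Es = edges I" and Ss: "distinct Ss" "set Ss = S"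
begin

definition entry :: "'v \<Rightarrow> 'v \<times> nat \<times> 'v list" where
  "entry v = (v, cap I v, pref I v)"

definition sat :: "'v \<Rightarrow> bool" where
  "sat v \<longleftrightarrow> degree_in S v = cap I v"

definition us where "us = costs (map entry As) (map entry Bs)"
definition fs where "fs = forced Es Ss"
definition src where "src = sources (map entry Bs) Ss"
definition snk where "snk = sinks (map entry As) Ss"

text \<open>Undoes the complementation on side \<open>B\<close>.\<close>

definition down :: "('v \<times> 'v) set \<Rightarrow> 'v \<Rightarrow> 'v \<Rightarrow> bool" where
  "down X v u \<longleftrightarrow> ((v, u) \<in> X \<longleftrightarrow> v \<in> sideA I)"

lemma edge_sides: "(a, b) \<in> edges I \<Longrightarrow> a \<in> sideA I \<and> b \<in> sideB I"
  using inst by (auto simp: smp_instance_def)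

lemma disjoint_sides: "v \<in> sideA I \<Longrightarrow> v \<notin> sideB I"
  using inst by (auto simp: smp_instance_def)

lemma edge_asym: "(a, b) \<in> edges I \<Longrightarrow> (b, a) \<notin> edges I"
  using edge_sides disjoint_sides by blast

lemma set_pref: "v \<in> verts I \<Longrightarrow> set (pref I v) = neighbours (edges I) v"
  and distinct_pref: "v \<in> verts I \<Longrightarrow> distinct (pref I v)"
  and finite_verts: "finite (verts I)"
  using inst by (auto simp: smp_instance_def verts_def)

lemma set_pref_A: "v \<in> sideA I \<Longrightarrow> u \<in> set (pref I v) \<longleftrightarrow> (v, u) \<in> edges I"
  and set_pref_B: "v \<in> sideB I \<Longrightarrow> u \<in> set (pref I v) \<longleftrightarrow> (u, v) \<in> edges I"
  by (auto simp: set_pref verts_def neighbours_def dest: edge_sides disjoint_sides)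

lemma neighbours_A: "v \<in> sideA I \<Longrightarrow> neighbours S v = {u. (v, u) \<in> S}"
  and neighbours_B: "v \<in> sideB I \<Longrightarrow> neighbours S v = {u. (u, v) \<in> S}"
  using S_edges by (auto simp: neighbours_def dest: edge_sides disjoint_sides)

text \<open>The program counts edges, \<open>degree_in\<close> counts neighbours. As the sides are
  disjoint, the edges at \<open>v\<close> correspond to their other ends.\<close>

lemma saturated_iff:
  assumes "v \<in> verts I"
  shows "saturated Ss v (cap I v) \<longleftrightarrow> sat v"
proof -
  let ?N = "{e \<in> S. fst e = v \<or> snd e = v}"
  have "length (filter (\<lambda>e. fst e = v \<or> snd e = v) Ss) = card ?N"
    using distinct_card[of "filter (\<lambda>e. fst e = v \<or> snd e = v) Ss"] Ss by simp
  also have "card ?N = degree_in S v"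
  proof (cases "v \<in> sideA I")
    case True
    then have "?N = Pair v ` {u. (v, u) \<in> S}"
      using S_edges by (force dest: edge_sides disjoint_sides)
    then show ?thesis using True by (simp add: degree_in_def neighbours_A card_image inj_on_def)
  next
    case False
    then have v: "v \<in> sideB I" using assms by (simp add: verts_def)
    then have "?N = (\<lambda>u. (u, v)) ` {u. (u, v) \<in> S}"
      using S_edges by (force dest: edge_sides disjoint_sides)
    then show ?thesis using v by (simp add: degree_in_def neighbours_B card_image inj_on_def)
  qed
  finally show ?thesis by (simp add: saturated_def sat_def)
qed

lemma set_snk: "(v, u) \<in> set snk \<longleftrightarrow> (v, u) \<in> edges I \<and> (\<not> sat v \<or> (v, u) \<in> S)"
proof -
  have "(v, u) \<in> set snk \<longleftrightarrow>
      v \<in> sideA I \<and> u \<in> set (pref I v) \<and> (\<not> saturated Ss v (cap I v) \<or> (v, u) \<in> S)"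
    by (auto simp: snk_def sinks_def entry_def As Ss)
  then show ?thesis
    using saturated_iff[of v] edge_sides[of v u] by (auto simp: set_pref_A verts_def)
qed

lemma set_src: "(v, u) \<in> set src \<longleftrightarrow> (u, v) \<in> edges I \<and> (\<not> sat v \<or> (u, v) \<in> S)"
proof -
  have "(v, u) \<in> set src \<longleftrightarrow>
      v \<in> sideB I \<and> u \<in> set (pref I v) \<and> (\<not> saturated Ss v (cap I v) \<or> (u, v) \<in> S)"
    by (auto simp: src_def sources_def entry_def Bs Ss)
  then show ?thesis
    using saturated_iff[of v] edge_sides[of u v] by (auto simp: set_pref_B verts_def)
qed

lemma src_snk_disjoint: "set src \<inter> set snk = {}"
  using edge_asym by (auto simp: set_src set_snk)

lemma set_fs: "set fs = {((b, a), (a, b)) | a b. (a, b) \<in> edges I - S}"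
  by (force simp: fs_def forced_def Es Ss)

lemma cut_us: "cut X us = (\<Sum>v\<in>verts I. inversions (down X v) (pref I v))"
proof -
  have "cut X us = (\<Sum>v\<leftarrow>As. inversions (\<lambda>u. (v, u) \<in> X) (pref I v))
      + (\<Sum>v\<leftarrow>Bs. inversions (\<lambda>u. (v, u) \<notin> X) (pref I v))"
    by (simp add: us_def costs_def cut_concat comp_def entry_def cut_costs_out cut_costs_in)
  also have "\<dots> = (\<Sum>v\<in>sideA I. inversions (\<lambda>u. (v, u) \<in> X) (pref I v))
      + (\<Sum>v\<in>sideB I. inversions (\<lambda>u. (v, u) \<notin> X) (pref I v))"
    by (simp add: As Bs sum_list_distinct_conv_sum_set)
  also have "\<dots> = (\<Sum>v\<in>sideA I. inversions (down X v) (pref I v))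
      + (\<Sum>v\<in>sideB I. inversions (down X v) (pref I v))"
    by (intro arg_cong2[where f = "(+)"] sum.cong arg_cong2[where f = inversions] ext)
      (auto simp: down_def dest: disjoint_sides)
  also have "\<dots> = (\<Sum>v\<in>verts I. inversions (down X v) (pref I v))"
    unfolding verts_def using finite_verts
    by (intro sum.union_disjoint[symmetric]) (auto simp: verts_def dest: disjoint_sides)
  finally show ?thesis .
qed

text \<open>By the degree bound, a free place is the negation of \<open>sat\<close>, which does not
  depend on the lists.\<close>

lemma stable_iff:
  "stable (I\<lparr>pref := L\<rparr>) S \<longleftrightarrow> (\<forall>a b. (a, b) \<in> edges I - S \<longrightarrow>
     (sat a \<and> (\<forall>b'. (a, b') \<in> S \<longrightarrow> \<not> prefers (I\<lparr>pref := L\<rparr>) a b b')) \<or>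
     (sat b \<and> (\<forall>a'. (a', b) \<in> S \<longrightarrow> \<not> prefers (I\<lparr>pref := L\<rparr>) b a a')))"
proof -
  have "degree_in S v < cap I v \<longleftrightarrow> \<not> sat v" if "v \<in> verts I" for v
    using degree_le[OF that] by (auto simp: sat_def)
  then have "blocking_edge (I\<lparr>pref := L\<rparr>) S a b \<longleftrightarrow> (a, b) \<in> edges I - S \<and>
     (\<not> sat a \<or> (\<exists>b'. (a, b') \<in> S \<and> prefers (I\<lparr>pref := L\<rparr>) a b b')) \<and>
     (\<not> sat b \<or> (\<exists>a'. (a', b) \<in> S \<and> prefers (I\<lparr>pref := L\<rparr>) b a a'))" for a b
    using edge_sides[of a b] by (cases "(a, b) \<in> edges I") (simp_all add: blocking_edge_def verts_def)
  then show ?thesis unfolding stable_def by blast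
qed

section \<open>From swap sequences to cuts\<close>

lemma swaps_eq: "set \<sigma>s \<subseteq> swaps I \<Longrightarrow> set \<sigma>s \<subseteq> {(v, i). Suc i < length (pref I v)}"
  by (auto simp: swaps_def)

text \<open>Such an arc comes from an edge outside \<open>S\<close> with a free place at both ends,
  which blocks for all lists.\<close>

lemma no_solution:
  assumes "f \<in> set fs" "fst f \<in> set src" "snd f \<in> set snk"
  shows "\<not> stabilizing I S \<sigma>s"
proof -
  obtain a b where "(a, b) \<in> edges I - S" "\<not> sat a" "\<not> sat b"
    using assms by (auto simp: set_fs set_src set_snk)
  then show ?thesis unfolding stabilizing_def stable_iff by blast
qed

text \<open>In a stable order, let the down set of a saturated vertex consist of what follows all its
  partners. It is a final segment, so all pairs counted by the cut have been swapped.\<close>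

lemma stabilizing_cut:
  assumes "stabilizing I S \<sigma>s"
  obtains X where "separates src snk X" "cut X fs = 0" "cut X us \<le> length \<sigma>s"
proof -
  define L where "L = fold apply_swap \<sigma>s (pref I)"
  have \<sigma>s: "set \<sigma>s \<subseteq> swaps I" and stab: "stable (I\<lparr>pref := L\<rparr>) S"
    using assms by (auto simp: stabilizing_def L_def)
  have L: "mset (L v) = mset (pref I v)" for v
    unfolding L_def using \<sigma>s by (intro mset_fold_apply_swap swaps_eq)
  have set_L: "set (L v) = neighbours (edges I) v" and distinct_L: "distinct (L v)"
    if "v \<in> verts I" for v
    using that set_pref distinct_pref L[of v] by (metis set_mset_mset, metis mset_eq_imp_distinct_iff)
  let ?pr = "prefers (I\<lparr>pref := L\<rparr>)"
  have pr: "?pr v u w \<longleftrightarrow> (\<exists>i j. i < j \<and> j < length (L v) \<and> L v ! i = u \<and> L v ! j = w)" for v u w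
    by (simp add: prefers_def)
  have pr_irrefl: "\<not> ?pr v u u" if "v \<in> verts I" for v u
    using distinct_L[OF that] by (auto simp: pr nth_eq_iff_index_eq)
  have pr_total: "?pr v w u" if "v \<in> verts I" "u \<in> set (L v)" "w \<in> set (L v)" "u \<noteq> w" "\<not> ?pr v u w" for v u w
    using that by (metis in_set_conv_nth linorder_neqE_nat pr)
  define dn where "dn v u \<longleftrightarrow> sat v \<and> (\<forall>w \<in> neighbours S v. ?pr v w u)" for v u
  define X where "X = {(v, u). v \<in> verts I \<and> (dn v u \<longleftrightarrow> v \<in> sideA I)}"
  have down: "down X v = dn v" if "v \<in> verts I" for v
    using that by (auto simp: down_def X_def)
  have "inversions (dn v) (L v) = 0" if "v \<in> verts I" for v
  proof (rule inversions_eq_0)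
    fix i j
    assume ij: "i < j" "j < length (L v)" and dn: "dn v (L v ! i)"
    have "?pr v w (L v ! j)" if "w \<in> neighbours S v" for w
    proof -
      have "?pr v w (L v ! i)" using dn that by (simp add: dn_def)
      \<comment> \<open>Distinctness gives \<open>m = i\<close>, so \<open>w\<close> at position
        \<open>k\<close> also precedes position \<open>j\<close>.\<close>
      then obtain k m where "k < m" "m < length (L v)" "L v ! k = w" "L v ! m = L v ! i"
        unfolding pr by blast
      then show ?thesis
        using ij distinct_L[OF \<open>v \<in> verts I\<close>] unfolding pr
        by (intro exI[of _ k] exI[of _ j]) (auto simp: nth_eq_iff_index_eq)
    qed
    then show "dn v (L v ! j)" using dn by (auto simp: dn_def)
  qed
  then have zero: "(\<Sum>v\<in>verts I. inversions (dn v) (L v)) = 0" by simp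
  have "cut X us = (\<Sum>v\<in>verts I. inversions (dn v) (pref I v))"
    unfolding cut_us by (intro sum.cong refl) (simp add: down)
  also have "\<dots> \<le> length \<sigma>s + (\<Sum>v\<in>verts I. inversions (dn v) (L v))"
    unfolding L_def using \<sigma>s by (intro sum_inversions_le finite_verts swaps_eq)
  finally have cost: "cut X us \<le> length \<sigma>s" using zero by simp
  have sep: "separates src snk X"
  proof -
    \<comment> \<open>A partner would have to precede itself.\<close>
    have "\<not> dn v u" if "(u, v) \<in> edges I" "\<not> sat v \<or> (u, v) \<in> S" for u v
      using that pr_irrefl[of v u] edge_sides[of u v] by (auto simp: dn_def neighbours_def verts_def)
    moreover have "\<not> dn v u" if "(v, u) \<in> edges I" "\<not> sat v \<or> (v, u) \<in> S" for u v
      using that pr_irrefl[of v u] edge_sides[of v u] by (auto simp: dn_def neighbours_def verts_def)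
    ultimately show ?thesis
      by (fastforce simp: separates_def set_src set_snk X_def verts_def dest: edge_sides disjoint_sides)
  qed
  have "dn a b \<or> dn b a" if ab: "(a, b) \<in> edges I - S" for a b
  proof -
    have v: "a \<in> sideA I" "b \<in> sideB I" "a \<in> verts I" "b \<in> verts I"
      using ab edge_sides by (auto simp: verts_def)
    have in_L: "b \<in> set (L a)" "a \<in> set (L b)" using ab v set_L by (auto simp: neighbours_def)
    consider "sat a" "\<And>b'. (a, b') \<in> S \<Longrightarrow> \<not> ?pr a b b'" | "sat b" "\<And>a'. (a', b) \<in> S \<Longrightarrow> \<not> ?pr b a a'"
      using stab ab unfolding stable_iff by blast
    then show ?thesis
    proof cases
      case 1
      have "?pr a b' b" if "(a, b') \<in> S" for b'
      proof (rule pr_total)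
        show "b' \<in> set (L a)" using that S_edges v set_L by (auto simp: neighbours_def)
      qed (use 1 that ab v in_L in auto)
      then show ?thesis using 1 v by (auto simp: dn_def neighbours_A)
    next
      case 2
      have "?pr b a' a" if "(a', b) \<in> S" for a'
      proof (rule pr_total)
        show "a' \<in> set (L b)" using that S_edges v set_L by (auto simp: neighbours_def)
      qed (use 2 that ab v in_L in auto)
      then show ?thesis using 2 v by (auto simp: dn_def neighbours_B)
    qed
  qed
  \<comment> \<open>If the tail \<open>(b, a)\<close> is in \<open>X\<close>, then \<open>a\<close>
    is not down at \<open>b\<close>; so \<open>b\<close> is down at \<open>a\<close>, and the head
    \<open>(a, b)\<close> is in \<open>X\<close>.\<close>
  then have "cut X fs = 0"
    by (auto simp: cut_eq_0_iff set_fs X_def verts_def dest: edge_sides disjoint_sides)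
  with sep cost show ?thesis using that by blast
qed

text \<open>Tails of forced arcs belong to side \<open>B\<close>, heads to side \<open>A\<close>. So
  the sources together with the heads of forced arcs leaving them are already closed, and by
  assumption no such head is a sink.\<close>

lemma feasible_cut:
  assumes "\<not> (\<exists>f \<in> set fs. fst f \<in> set src \<and> snd f \<in> set snk)"
  shows "\<exists>X. separates src snk X \<and> cut X fs = 0"
proof (intro exI conjI)
  let ?X = "set src \<union> snd ` {f \<in> set fs. fst f \<in> set src}"
  show "separates src snk ?X"
    using assms src_snk_disjoint by (auto simp: separates_def)
  show "cut ?X fs = 0"
    by (auto simp: cut_eq_0_iff set_fs set_src image_iff dest: edge_sides disjoint_sides)
qed

section \<open>From cuts to swap sequences\<close>

definition sorting :: "('v \<times> 'v) set \<Rightarrow> ('v \<times> nat) list" where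
  "sorting X = concat (map (\<lambda>v. map (Pair v) (partition_swaps (down X v) (pref I v))) (As @ Bs))"

lemma length_sorting: "length (sorting X) = cut X us"
proof -
  have d: "distinct (As @ Bs)" "set (As @ Bs) = verts I"
    using As Bs disjoint_sides by (auto simp: verts_def)
  have "length (sorting X) = (\<Sum>v\<leftarrow>As @ Bs. inversions (down X v) (pref I v))"
    by (simp add: sorting_def length_concat comp_def length_partition_swaps)
  also have "\<dots> = cut X us"
    unfolding sum_list_distinct_conv_sum_set[OF d(1)] d(2) cut_us ..
  finally show ?thesis .
qed

text \<open>A separating cut moves entries down only at saturated vertices, and never partners. As
  no forced arc is cut, every edge outside \<open>S\<close> is moved down at one end, where it
  cannot block.\<close>

lemma stabilizing_sorting:
  assumes sep: "separates src snk X" and X: "cut X fs = 0"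
  shows "stabilizing I S (sorting X)"
proof -
  define L where "L = fold apply_swap (sorting X) (pref I)"
  have L: "L v = filter (\<lambda>u. \<not> down X v u) (pref I v) @ filter (down X v) (pref I v)"
    if "v \<in> verts I" for v
    unfolding L_def sorting_def using that As Bs disjoint_sides
    by (subst fold_apply_swap_concat) (auto simp: verts_def fold_partition_swaps)
  have not_prefers: "\<not> prefers (I\<lparr>pref := L\<rparr>) v u w" if "v \<in> verts I" "down X v u" "\<not> down X v w" for v u w
  proof
    let ?xs = "filter (\<lambda>u. \<not> down X v u) (pref I v)" and ?ys = "filter (down X v) (pref I v)"
    assume "prefers (I\<lparr>pref := L\<rparr>) v u w"
    moreover have P: "pref (I\<lparr>pref := L\<rparr>) v = ?xs @ ?ys" using L[OF that(1)] by simp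
    ultimately have "\<exists>i j. i < j \<and> j < length (?xs @ ?ys) \<and> (?xs @ ?ys) ! i = u \<and> (?xs @ ?ys) ! j = w"
      by (simp only: prefers_def P)
    then obtain i j where ij: "i < j" "j < length (?xs @ ?ys)" "(?xs @ ?ys) ! i = u" "(?xs @ ?ys) ! j = w"
      by blast
    \<comment> \<open>\<open>u\<close> lies in the second block and \<open>w\<close> in the first,
      contrary to \<open>i < j\<close>.\<close>
    have "length ?xs \<le> i"
      using ij(3) that(2) nth_mem[of i ?xs] by (force simp: nth_append split: if_splits)
    moreover have "j < length ?xs"
      using ij(2,4) that(3) nth_mem[of "j - length ?xs" ?ys] by (force simp: nth_append split: if_splits)
    ultimately show False using ij(1) by simp
  qed
  have "stable (I\<lparr>pref := L\<rparr>) S"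
    unfolding stable_iff
  proof (intro allI impI disjCI)
    fix a b
    assume ab: "(a, b) \<in> edges I - S"
      and nb: "\<not> (sat b \<and> (\<forall>a'. (a', b) \<in> S \<longrightarrow> \<not> prefers (I\<lparr>pref := L\<rparr>) b a a'))"
    have v: "a \<in> sideA I" "b \<in> sideB I" "a \<in> verts I" "b \<in> verts I" "b \<notin> sideA I"
      using ab edge_sides disjoint_sides by (auto simp: verts_def)
    have srcX: "(w, u) \<in> X" if "(u, w) \<in> edges I" "\<not> sat w \<or> (u, w) \<in> S" for u w
      using that sep set_src by (auto simp: separates_def)
    have snkX: "(w, u) \<notin> X" if "(w, u) \<in> edges I" "\<not> sat w \<or> (w, u) \<in> S" for u w
      using that sep set_snk by (auto simp: separates_def)
    \<comment> \<open>Otherwise \<open>b\<close> would be saturated and prefer \<open>a\<close> to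
      none of its partners, contrary to \<open>nb\<close>.\<close>
    have "\<not> down X b a"
    proof
      assume D: "down X b a"
      then have "sat b" using srcX[of a b] ab v by (auto simp: down_def)
      moreover have "\<not> prefers (I\<lparr>pref := L\<rparr>) b a a'" if "(a', b) \<in> S" for a'
        using that D srcX[of a' b] S_edges v by (intro not_prefers) (auto simp: down_def)
      ultimately show False using nb by blast
    qed
    then have "(a, b) \<in> X"
      using X ab v by (auto simp: cut_eq_0_iff set_fs down_def)
    then have D: "down X a b" using v by (simp add: down_def)
    then have "sat a" using snkX[of a b] ab v by (auto simp: down_def)
    moreover have "\<not> prefers (I\<lparr>pref := L\<rparr>) a b b'" if "(a, b') \<in> S" for b'
      using that D snkX[of a b'] S_edges v by (intro not_prefers) (auto simp: down_def)
    ultimately show "sat a \<and> (\<forall>b'. (a, b') \<in> S \<longrightarrow> \<not> prefers (I\<lparr>pref := L\<rparr>) a b b')" by blast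
  qed
  moreover have "set (sorting X) \<subseteq> swaps I"
    using As Bs by (auto simp: sorting_def swaps_def verts_def partition_swaps_bound)
  ultimately show ?thesis by (simp add: stabilizing_def L_def)
qed

section \<open>Optimality of the computed sequence\<close>

lemma solve_eq:
  "solve ((map entry As, map entry Bs), (Es, Ss)) =
    (if \<exists>f \<in> set fs. fst f \<in> set src \<and> snd f \<in> set snk then None
     else Some (sorting (set (min_cut src snk (amplify us fs)))))"
proof -
  let ?R = "set (min_cut src snk (amplify us fs))"
  have "down ?R v = (\<lambda>u. (v, u) \<in> ?R)" if "v \<in> set As" for v
    using that by (simp add: fun_eq_iff down_def As)
  then have 1: "map (\<lambda>v. map (Pair v) (partition_swaps (\<lambda>u. (v, u) \<in> ?R) (pref I v))) As
      = map (\<lambda>v. map (Pair v) (partition_swaps (down ?R v) (pref I v))) As"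
    by (intro map_cong refl) simp
  have "down ?R v = (\<lambda>u. (v, u) \<notin> ?R)" if "v \<in> set Bs" for v
    using that disjoint_sides by (auto simp: fun_eq_iff down_def Bs)
  then have 2: "map (\<lambda>v. map (Pair v) (partition_swaps (\<lambda>u. (v, u) \<notin> ?R) (pref I v))) Bs
      = map (\<lambda>v. map (Pair v) (partition_swaps (down ?R v) (pref I v))) Bs"
    by (intro map_cong refl) simp
  show ?thesis
    unfolding solve_def Let_def prod.case src_def[symmetric] snk_def[symmetric] fs_def[symmetric] us_def[symmetric]
    by (simp add: sorting_def comp_def entry_def 1 2)
qed

lemma solve_correct:
  "case solve ((map entry As, map entry Bs), (Es, Ss)) of
     None \<Rightarrow> \<nexists>\<sigma>s. stabilizing I S \<sigma>s
   | Some \<sigma>s \<Rightarrow> is_arg_min length (stabilizing I S) \<sigma>s"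
proof (cases "\<exists>f \<in> set fs. fst f \<in> set src \<and> snd f \<in> set snk")
  case True
  then show ?thesis using no_solution by (auto simp: solve_eq)
next
  case False
  let ?net = "amplify us fs"
  let ?R = "set (min_cut src snk ?net)"
  obtain Y where Y: "separates src snk Y" "cut Y fs = 0"
    using feasible_cut[OF False] by blast
  have sep: "separates src snk ?R"
    using src_snk_disjoint by (rule separates_min_cut)
  \<comment> \<open>\<open>Y\<close> cuts no forced arc, so the minimum is below
    \<open>Suc (length us)\<close>, the weight of a single forced arc.\<close>
  have "cut ?R ?net \<le> length us"
    using min_cut_le[OF Y(1), of ?net] cut_le_length[of Y us] by (simp add: cut_amplify Y(2))
  then have R: "cut ?R fs = 0" by (cases "cut ?R fs") (auto simp: cut_amplify)
  \<comment> \<open>The cut derived from \<open>\<sigma>s\<close> costs at most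
    \<open>length \<sigma>s\<close>, and the minimum cut costs no more.\<close>
  have "length (sorting ?R) \<le> length \<sigma>s" if \<sigma>s: "stabilizing I S \<sigma>s" for \<sigma>s
  proof -
    obtain X where "separates src snk X" "cut X fs = 0" "cut X us \<le> length \<sigma>s"
      using stabilizing_cut[OF \<sigma>s] .
    then show ?thesis
      using min_cut_le[of src snk X ?net] by (simp add: cut_amplify length_sorting R)
  qed
  then show ?thesis
    using False stabilizing_sorting[OF sep R] by (auto simp: solve_eq is_arg_min_def not_less)
qed

end

section \<open>Polynomial running time\<close>

text \<open>Equality of nodes and arcs is decidable in polynomial time by
  \<open>ptime_eq_nat\<close> and \<open>ptime_eq_prod\<close>, as membership tests and
  \<open>remove1\<close> require.\<close>

type_synonym node = "nat \<times> nat"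

section \<open>Search and augmentation in polynomial time\<close>

lemma ptime_swap [ptime_intros]: "ptime f \<Longrightarrow> ptime (\<lambda>x. prod.swap (f x))"
  unfolding prod.swap_def by (intro ptime_intros)

lemma size_enc_remove1: "size (enc (remove1 x xs)) \<le> size (enc xs)"
  by (induction xs) auto

lemma ptime_remove1 [ptime_intros]:
  fixes f :: "'a::enc \<Rightarrow> 'b::enc"
  assumes eq: "ptime (\<lambda>z :: 'b \<times> 'b. fst z = snd z)" and f: "ptime f" and xs: "ptime xs"
  shows "ptime (\<lambda>x. remove1 (f x) (xs x))"
proof (rule ptime_rec[where f = "\<lambda>y x xs r. if y = x then xs else x # r" and h = remove1
      and g = "\<lambda>y. []"])
  show "psize (\<lambda>z :: 'b \<times> 'b list. remove1 (fst z) (snd z))"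
    by (rule psizeI[where q = "[:0, 1:]"]) (auto simp: le_SucI trans_le_add2 size_enc_remove1)
qed (intro ptime_comp2[where f = "(=)", OF eq] ptime_intros f xs | simp)+

lemma ptime_removes [ptime_intros]:
  fixes f g :: "'a::enc \<Rightarrow> (node \<times> node) list"
  assumes f: "ptime f" and g: "ptime g"
  shows "ptime (\<lambda>x. removes (f x) (g x))"
proof (rule ptime_rec[where f = "\<lambda>as b bs r. remove1 b r" and h = removes and g = "\<lambda>as. as"])
  have "size (enc (removes as bs)) \<le> size (enc as)" for as bs :: "(node \<times> node) list"
    by (induction bs) (auto intro: order_trans[OF size_enc_remove1])
  then show "psize (\<lambda>z :: (node \<times> node) list \<times> (node \<times> node) list. removes (fst z) (snd z))"
    by (intro psizeI[where q = "[:0, 1:]"]) (auto simp: le_SucI trans_le_add1)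
qed (intro ptime_intros f g | simp)+

lemma ptime_reached [ptime_intros]:
  "ptime ss \<Longrightarrow> ptime T \<Longrightarrow> ptime (\<lambda>x. reached (ss x) (T x))"
  unfolding reached_def by (intro ptime_intros)

lemma ptime_add [ptime_intros]:
  fixes ss :: "'a::enc \<Rightarrow> node list"
  shows "ptime ss \<Longrightarrow> ptime a \<Longrightarrow> ptime T \<Longrightarrow> ptime (\<lambda>x. add (ss x) (a x) (T x))"
  unfolding add_def by (intro ptime_intros)

text \<open>The growth in one pass does not depend on \<open>T\<close>, so over several passes it
  adds up instead of multiplying.\<close>

lemma size_enc_scan: "size (enc (scan ss T as)) \<le> size (enc T) + size (enc as)"
  by (induction as) (auto simp: add_def size_enc_append)

lemma ptime_scan [ptime_intros]:
  fixes ss :: "'a::enc \<Rightarrow> node list"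
  assumes "ptime ss" "ptime T" "ptime as"
  shows "ptime (\<lambda>x. scan (ss x) (T x) (as x))"
proof -
  \<comment> \<open>\<open>ptime_rec\<close> allows one parameter, so \<open>ss\<close> and
    \<open>T\<close> are packed into a pair.\<close>
  have "ptime (\<lambda>x. (\<lambda>e. scan (fst e) (snd e)) (ss x, T x) (as x))"
  proof (rule ptime_rec[where f = "\<lambda>e a as r. add (fst e) a r"
        and h = "\<lambda>e. scan (fst e) (snd e)" and g = "\<lambda>e. snd e"])
    show "psize (\<lambda>z :: (node list \<times> (node \<times> node) list) \<times> (node \<times> node) list.
        scan (fst (fst z)) (snd (fst z)) (snd z))"
      by (intro psizeI[where q = "[:0, 1:]"]) (auto intro: order_trans[OF size_enc_scan])
  qed (intro ptime_intros assms | simp)+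
  then show ?thesis by simp
qed

lemma size_enc_scans: "size (enc (scans ss as bs)) \<le> length bs * size (enc as)"
proof (induction bs)
  case (Cons b bs)
  then show ?case using size_enc_scan[of ss "scans ss as bs" as] by simp
qed simp

lemma ptime_search [ptime_intros]:
  fixes ss :: "'a::enc \<Rightarrow> node list"
  assumes "ptime ss" "ptime as"
  shows "ptime (\<lambda>x. search (ss x) (as x))"
proof -
  have "ptime (\<lambda>x. (\<lambda>e. scans (fst e) (snd e)) (ss x, as x) (as x))"
  proof (rule ptime_rec[where f = "\<lambda>e b bs r. scan (fst e) r (snd e)"
        and h = "\<lambda>e. scans (fst e) (snd e)" and g = "\<lambda>e. []"])
    show "psize (\<lambda>z :: (node list \<times> (node \<times> node) list) \<times> (node \<times> node) list.
        scans (fst (fst z)) (snd (fst z)) (snd z))"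
    proof (rule psizeI[where q = "[:0, 1:] * [:0, 1:]"])
      fix z :: "(node list \<times> (node \<times> node) list) \<times> (node \<times> node) list"
      obtain ss as bs where z: "z = ((ss, as), bs)" by (metis prod.collapse)
      have "length bs * size (enc as) \<le> size (enc z) * size (enc z)"
        using length_le_size_enc[of bs] by (intro mult_mono) (auto simp: z)
      then show "size (enc (scans (fst (fst z)) (snd (fst z)) (snd z)))
          \<le> poly ([:0, 1:] * [:0, 1:]) (size (enc z))"
        using size_enc_scans[of ss as bs] by (simp add: z)
    qed
  qed (intro ptime_intros assms | simp)+
  then show ?thesis by (simp add: search_def)
qed

lemma size_enc_trace:
  "size (enc (fst (trace v T))) \<le> size (enc v) + size (enc T)"
  "size (enc (snd (trace v T))) \<le> size (enc T)"
proof (induction T)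
  case (Cons a T)
  have "size (enc (fst a)) \<le> size (enc a)" by (cases a) simp
  then show "size (enc (fst (trace v (a # T)))) \<le> size (enc v) + size (enc (a # T))"
    using Cons by (auto simp: Let_def case_prod_beta)
  show "size (enc (snd (trace v (a # T)))) \<le> size (enc (a # T))"
    using Cons by (auto simp: Let_def case_prod_beta)
qed auto

lemma ptime_trace [ptime_intros]:
  fixes v :: "'a::enc \<Rightarrow> node"
  assumes "ptime v" "ptime T"
  shows "ptime (\<lambda>x. trace (v x) (T x))"
proof (rule ptime_rec[where f = "\<lambda>v a T r. let (w, p) = r in if snd a = w then (fst a, a # p) else (w, p)"
      and h = trace and g = "\<lambda>v. (v, [])"])
  show "psize (\<lambda>z :: node \<times> (node \<times> node) list. trace (fst z) (snd z))"
  proof (rule psizeI[where q = "[:1, 2:]"])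
    fix z :: "node \<times> (node \<times> node) list"
    obtain v T where z: "z = (v, T)" by (cases z)
    have "size (enc (trace v T)) = Suc (size (enc (fst (trace v T))) + size (enc (snd (trace v T))))"
      by (cases "trace v T") simp
    then show "size (enc (trace (fst z) (snd z))) \<le> poly [:1, 2:] (size (enc z))"
      using size_enc_trace[of v T] by (simp add: z)
  qed
qed (intro ptime_intros assms | simp)+

lemma ptime_flip_path [ptime_intros]:
  fixes p :: "'a::enc \<Rightarrow> (node \<times> node) list"
  shows "ptime p \<Longrightarrow> ptime as \<Longrightarrow> ptime (\<lambda>x. flip_path (p x) (as x))"
  unfolding flip_path_def by (intro ptime_intros)

lemma ptime_augment [ptime_intros]:
  fixes ss :: "'a::enc \<Rightarrow> node list"
  assumes "ptime ss" "ptime ts" "ptime as"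
  shows "ptime (\<lambda>x. augment (ss x) (ts x) (as x))"
  \<comment> \<open>Below the bindings the arguments are read from an extended environment, so the
    assumptions are needed in composed form.\<close>
  unfolding augment_def by (intro ptime_intros assms[THEN ptime_comp])

lemma size_enc_mset: "size (enc xs) = (\<Sum>x\<in>#mset xs. Suc (size (enc x)))"
  by (induction xs) auto

text \<open>Reversing an arc preserves the size of its code, so residual graphs do not grow over the
  rounds.\<close>

lemma size_enc_augment: "size (enc (augment ss ts as)) = size (enc as)"
proof (rule augment_cases[of ss ts as])
  fix p u v
  assume *: "augment ss ts as = flip_path p as" "mset p \<subseteq># mset as"
  have "size (enc (prod.swap a)) = size (enc a)" for a :: "'a \<times> 'a" by (cases a) simp
  then have "size (enc (map prod.swap p)) = size (enc p)" by (induction p) auto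
  moreover have "size (enc (flip_path p as @ p)) = size (enc (as @ map prod.swap p))"
    using mset_flip_path[OF *(2)] by (simp only: size_enc_mset mset_append)
  ultimately show ?thesis by (simp add: *(1) size_enc_append)
qed simp

lemma ptime_min_cut [ptime_intros]:
  fixes ss :: "'a::enc \<Rightarrow> node list"
  assumes "ptime ss" "ptime ts" "ptime as"
  shows "ptime (\<lambda>x. min_cut (ss x) (ts x) (as x))"
proof -
  have "ptime (\<lambda>x. (\<lambda>e. augments (fst e) (fst (snd e)) (snd (snd e))) (ss x, ts x, as x) (as x))"
  proof (rule ptime_rec[where f = "\<lambda>e b bs r. augment (fst e) (fst (snd e)) r"
        and h = "\<lambda>e. augments (fst e) (fst (snd e)) (snd (snd e))" and g = "\<lambda>e. snd (snd e)"])
    have "size (enc (augments ss ts as bs)) = size (enc as)"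
      for ss ts :: "node list" and as bs :: "(node \<times> node) list"
      by (induction bs) (auto simp: size_enc_augment)
    then show "psize (\<lambda>z :: (node list \<times> node list \<times> (node \<times> node) list) \<times> (node \<times> node) list.
        augments (fst (fst z)) (fst (snd (fst z))) (snd (snd (fst z))) (snd z))"
      by (intro psizeI[where q = "[:0, 1:]"]) auto
  qed (intro ptime_intros assms | simp)+
  then have "ptime (\<lambda>x. augments (ss x) (ts x) (as x) (as x))" by simp
  then show ?thesis unfolding min_cut_def by (intro ptime_intros assms)
qed

section \<open>Network and swaps in polynomial time\<close>

lemma inversions_le: "inversions D l \<le> length l * length l"
proof (induction l)
  case (Cons x l)
  then show ?case
    using length_filter_le[of "\<lambda>y. \<not> D y" l] by (simp del: length_filter_le)
qed simp

text \<open>The swaps are at most quadratic in number and each is a position in the list, which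
  bounds the size of the result.\<close>

lemma ptime_partition_swaps [ptime_intros]:
  assumes D: "ptime (\<lambda>z. D (fst z) (snd z))" and l: "ptime l"
  shows "ptime (\<lambda>x. partition_swaps (\<lambda>u. D x u) (l x))"
proof (rule ptime_rec[where e = "\<lambda>x. x" and h = "\<lambda>x. partition_swaps (D x)" and g = "\<lambda>x. []"
      and f = "\<lambda>x u us r. map (\<lambda>i. Suc i) r
        @ (if D x u then [0..<length (filter (\<lambda>y. \<not> D x y) us)] else [])"])
  show "psize (\<lambda>z. partition_swaps (D (fst z)) (snd z))"
  proof (rule psizeI[where q = "[:0, 1:] * [:0, 1:] * (1 + [:0, 2:])"])
    fix z :: "'a \<times> 'b list"
    obtain x us where z: "z = (x, us)" by (cases z)
    let ?n = "size (enc z)"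
    have us: "length us \<le> ?n" using length_le_size_enc[of us] by (simp add: z)
    have "size (enc i) \<le> 2 * ?n" if "i \<in> set (partition_swaps (D x) us)" for i
      using size_enc_nat[of i] partition_swaps_bound[OF that] us by linarith
    then have "size (enc (partition_swaps (D x) us)) \<le> inversions (D x) us * Suc (2 * ?n)"
      unfolding length_partition_swaps[symmetric] by (rule size_enc_le)
    also have "\<dots> \<le> (?n * ?n) * Suc (2 * ?n)"
      by (intro mult_right_mono order_trans[OF inversions_le] mult_mono us) auto
    finally show "size (enc (partition_swaps (D (fst z)) (snd z)))
        \<le> poly ([:0, 1:] * [:0, 1:] * (1 + [:0, 2:])) ?n"
      by (simp add: z algebra_simps)
  qed
qed (intro ptime_intros ptime_comp2[OF D] l | simp)+

lemma ptime_ordered_pairs [ptime_intros]: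
  fixes f :: "'a::enc \<Rightarrow> 'b::enc list"
  assumes "ptime f"
  shows "ptime (\<lambda>x. ordered_pairs (f x))"
proof (rule ptime_rec[where e = "\<lambda>x. x" and h = "\<lambda>x. ordered_pairs" and g = "\<lambda>x. []"
      and f = "\<lambda>e x xs r. map (\<lambda>y. (x, y)) xs @ r"])
  show "psize (\<lambda>z :: 'a \<times> 'b list. ordered_pairs (snd z))"
  proof (rule psizeI[where q = "[:0, 1:] * [:0, 1:] * (2 + [:0, 2:])"])
    fix z :: "'a \<times> 'b list"
    obtain x l where z: "z = (x, l)" by (cases z)
    let ?n = "size (enc z)"
    have l: "length l \<le> ?n" using length_le_size_enc[of l] by (simp add: z)
    have len: "length (ordered_pairs l) \<le> length l * length l" by (induction l) auto
    have sub: "set (ordered_pairs l) \<subseteq> set l \<times> set l" by (induction l) auto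
    have "size (enc e) \<le> Suc (2 * ?n)" if "e \<in> set (ordered_pairs l)" for e
    proof -
      obtain a b where e: "e = (a, b)" by (cases e)
      then have "a \<in> set l" "b \<in> set l" using sub that by auto
      then show ?thesis using size_enc_mem[of a l] size_enc_mem[of b l] by (simp add: e z)
    qed
    then have "size (enc (ordered_pairs l)) \<le> length (ordered_pairs l) * Suc (Suc (2 * ?n))"
      by (rule size_enc_le)
    also have "\<dots> \<le> (?n * ?n) * Suc (Suc (2 * ?n))"
      by (intro mult_right_mono order_trans[OF len] mult_mono l) auto
    finally show "size (enc (ordered_pairs (snd z))) \<le> poly ([:0, 1:] * [:0, 1:] * (2 + [:0, 2:])) ?n"
      by (simp add: z algebra_simps)
  qed
qed (intro ptime_intros assms | simp)+

lemma ptime_saturated [ptime_intros]: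
  fixes v :: "'a::enc \<Rightarrow> nat"
  assumes "ptime Ss" "ptime v" "ptime c"
  shows "ptime (\<lambda>x. saturated (Ss x) (v x) (c x))"
  unfolding saturated_def by (intro ptime_intros assms[THEN ptime_comp])

lemma ptime_solve: "ptime (solve :: _ \<Rightarrow> (nat \<times> nat) list option)"
  unfolding solve_def sources_def sinks_def forced_def amplify_def costs_def
  by (intro ptime_intros)

section \<open>Agreement with the prescribed encoding\<close>

lemma encodes_input:
  assumes "smp_instance I" "S \<subseteq> edges I" "\<forall>v \<in> verts I. degree_in S v \<le> cap I v" "encodes x I S"
  obtains As Bs Es Ss where "smp_input I S As Bs Es Ss"
    "x = enc ((map (smp_input.entry I) As, map (smp_input.entry I) Bs), (Es, Ss))"
proof -
  obtain As Bs Es Ss where *: "distinct As" "set As = sideA I" "distinct Bs" "set Bs = sideB I"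
      "set Es = edges I" "distinct Ss" "set Ss = S"
    and x: "x = Node (Node (enc_list (enc_vertex I) As) (enc_list (enc_vertex I) Bs))
                 (Node (enc_list (enc_pair enc_nat enc_nat) Es) (enc_list (enc_pair enc_nat enc_nat) Ss))"
    using assms(4) unfolding encodes_def by blast
  interpret smp_input I S As Bs Es Ss
    using assms * by unfold_locales auto
  have nats: "enc_list enc_nat l = enc l" for l
    by (induction l) (auto simp: enc_list_def nat_enc)
  \<comment> \<open>A triple is a nested pair, so \<open>entry v\<close> has exactly the code
    \<open>enc_vertex I v\<close>.\<close>
  have "enc_list (enc_vertex I) vs = enc (map entry vs)" for vs
    by (induction vs) (auto simp: enc_list_def enc_vertex_def entry_def nat_enc nats[unfolded enc_list_def])
  moreover have "enc_list (enc_pair enc_nat enc_nat) es = enc es" for es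
    by (induction es) (auto simp: enc_list_def enc_pair_def prod_enc nat_enc)
  ultimately show ?thesis
    using x by (intro that[of As Bs Es Ss]) (auto intro: smp_input_axioms)
qed

lemma enc_output_eq: "enc_output r = enc r"
proof -
  have "enc_nat = enc" by (rule ext) (simp add: nat_enc)
  moreover have "enc_pair (enc :: nat \<Rightarrow> tree) (enc :: nat \<Rightarrow> tree) = enc" by (rule ext) (simp add: prod_enc)
  moreover have "enc_list (enc :: nat \<times> nat \<Rightarrow> tree) = enc" by (rule ext) (simp add: list_enc)
  ultimately show ?thesis by (simp add: enc_output_def option_enc)
qed

theorem theorem2:
  "\<exists>(p :: prog) (q :: nat poly). \<forall>(I :: nat smp) (S :: (nat \<times> nat) set) (x :: tree).
     smp_instance I \<and> S \<subseteq> edges I \<and> (\<forall>v \<in> verts I. degree_in S v \<le> cap I v) \<and>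
     encodes x I S \<longrightarrow>
     (\<exists>r t. exec p x (enc_output r) t \<and> t \<le> poly q (size x) \<and>
        (case r of
           None \<Rightarrow> \<nexists>\<sigma>s. stabilizing I S \<sigma>s
         | Some \<sigma>s \<Rightarrow> is_arg_min length (stabilizing I S) \<sigma>s))"
proof -
  obtain p t q where solve: "\<And>z. exec p (enc z) (enc (solve z :: (nat \<times> nat) list option)) (t z)"
      "\<And>z. t z \<le> poly q (size (enc z))"
    using ptime_solve by (rule ptimeE) (rule that)
  show ?thesis
  proof (intro exI[of _ p] exI[of _ q] allI impI, elim conjE)
    fix I :: "nat smp" and S :: "(nat \<times> nat) set" and x
    assume "smp_instance I" "S \<subseteq> edges I" "\<forall>v \<in> verts I. degree_in S v \<le> cap I v" "encodes x I S"
    then obtain As Bs Es Ss where i: "smp_input I S As Bs Es Ss"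
      and x: "x = enc ((map (smp_input.entry I) As, map (smp_input.entry I) Bs), (Es, Ss))"
      by (rule encodes_input)
    show "\<exists>r t. exec p x (enc_output r) t \<and> t \<le> poly q (size x) \<and>
        (case r of
           None \<Rightarrow> \<nexists>\<sigma>s. stabilizing I S \<sigma>s
         | Some \<sigma>s \<Rightarrow> is_arg_min length (stabilizing I S) \<sigma>s)"
      unfolding x enc_output_eq using solve smp_input.solve_correct[OF i] by blast
  qed
qed

end
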